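(* There exist absolute constants $c>0$ and $C>0$ such that the following holds. Let $p$ be a prime, $n\geq 3$, $V$ an $n$-dimensional vector space over $\mathbb{F}_p$, and let $X\subseteq SL(V)$ be a symmetric generating set of $SL(V)$ with $1\in X$ which contains a transvection. Then for some $l\le C(\log p)^c n^2$, the set $X^l$ contains a full transvection group $s^{\mathbb{F}_p}$ for some transvection $s$.
   Context: A transvection is an element $s=1+d\otimes\phi\in SL(V)$, acting by $x\mapsto x+\phi(x)d$, with $0\neq d\in V$, $0\neq \phi\in V^*$, $\phi(d)=0$; its transvection group is $s^{\mathbb{F}_p}=\{1+\lambda\, d\otimes\phi:\lambda\in\mathbb{F}_p\}$. For $k\in\mathbb{N}$, $X^k=\{x_1\cdots x_k: x_i\in X\}$ (since $1\in X$, $X^k\subseteq X^l$ for $k\le l$). *)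

theory Defs
  imports Complex_Main "Jordan_Normal_Form.Determinant"
begin

text \<open>Model: V = F_p^n (after a choice of basis), elements of End(V) are n x n integer
  matrices with entries in {0..<p}; arithmetic is reduced mod p.\<close>

definition reduced_mat :: "nat \<Rightarrow> nat \<Rightarrow> int mat \<Rightarrow> bool" where
  "reduced_mat p n A \<longleftrightarrow> A \<in> carrier_mat n n \<and>
     (\<forall>i<n. \<forall>j<n. 0 \<le> A $$ (i,j) \<and> A $$ (i,j) < int p)"

definition modp_mat :: "nat \<Rightarrow> int mat \<Rightarrow> int mat" where
  "modp_mat p A = map_mat (\<lambda>x. x mod int p) A"

definition mulp :: "nat \<Rightarrow> int mat \<Rightarrow> int mat \<Rightarrow> int mat" where
  "mulp p A B = modp_mat p (A * B)"

definition SLp :: "nat \<Rightarrow> nat \<Rightarrow> int mat set" where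
  "SLp p n = {A. reduced_mat p n A \<and> det A mod int p = 1}"

definition invp :: "nat \<Rightarrow> nat \<Rightarrow> int mat \<Rightarrow> int mat" where
  "invp p n A = (THE B. B \<in> SLp p n \<and> mulp p A B = 1\<^sub>m n)"

inductive_set gen_SLp :: "nat \<Rightarrow> nat \<Rightarrow> int mat set \<Rightarrow> int mat set"
  for p n X where
  one: "1\<^sub>m n \<in> gen_SLp p n X"
| base: "A \<in> X \<Longrightarrow> A \<in> gen_SLp p n X"
| mult: "A \<in> gen_SLp p n X \<Longrightarrow> B \<in> gen_SLp p n X \<Longrightarrow> mulp p A B \<in> gen_SLp p n X"
| inv: "A \<in> gen_SLp p n X \<Longrightarrow> invp p n A \<in> gen_SLp p n X"

definition symmetric_set :: "nat \<Rightarrow> nat \<Rightarrow> int mat set \<Rightarrow> bool" where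
  "symmetric_set p n X \<longleftrightarrow> (\<forall>A\<in>X. invp p n A \<in> X)"

fun Xpow :: "nat \<Rightarrow> nat \<Rightarrow> int mat set \<Rightarrow> nat \<Rightarrow> int mat set" where
  "Xpow p n X 0 = {1\<^sub>m n}"
| "Xpow p n X (Suc k) = {mulp p A B | A B. A \<in> X \<and> B \<in> Xpow p n X k}"

definition reduced_vec :: "nat \<Rightarrow> nat \<Rightarrow> int vec \<Rightarrow> bool" where
  "reduced_vec p n v \<longleftrightarrow> v \<in> carrier_vec n \<and> (\<forall>i<n. 0 \<le> v $ i \<and> v $ i < int p)"

definition transvection :: "nat \<Rightarrow> nat \<Rightarrow> int mat \<Rightarrow> bool" where
  "transvection p n s \<longleftrightarrow> (\<exists>d \<phi>. reduced_vec p n d \<and> reduced_vec p n \<phi> \<and>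
      d \<noteq> 0\<^sub>v n \<and> \<phi> \<noteq> 0\<^sub>v n \<and> (\<phi> \<bullet> d) mod int p = 0 \<and>
      s = modp_mat p (1\<^sub>m n + mat n n (\<lambda>(i,j). d $ i * \<phi> $ j)))"

definition transvection_group :: "nat \<Rightarrow> nat \<Rightarrow> int mat \<Rightarrow> int mat set" where
  "transvection_group p n s =
     {modp_mat p (1\<^sub>m n + a \<cdot>\<^sub>m (s - 1\<^sub>m n)) | a. 0 \<le> a \<and> a < int p}"

end

(*
The transvection t = 1 + d (x) phi and a conjugate t' = 1 + d' (x) phi' with phi(d') and phi'(d)
both nonzero generate a copy of SL_2(p) in which t is upper and t' lower unipotent.

A suitable conjugating element g is short: phi(g d) phi(g^-1 d) = phi(g^-1 D g d) for D = d (x) phi,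
and the matrices M with phi(g^-1 M g d) = 0 for all g in X^k form a decreasing chain of additive
groups, of size at most p^(n^2). At each step the size at least halves or the chain has stabilised
at a set invariant under conjugation by SL_n(p), which cannot contain D. So some g in X^k with
2^k > p^(n^2) works, and this is where the factor n^2 log p comes from.

Inside SL_2(p) the sets A_l of elements of length l grow like |A_(92 l)| >> |A_l|^(3/2) until they
contain all upper unipotents, which takes O(log log p) steps. If A_l has r points g(infinity) on the
projective line, pigeonhole gives |A_l|/r elements of the Borel subgroup in A_2l. A pivot argument
combines their torus parts and unipotent parts into many upper unipotents: either half of them, hence
all, or about |A_l|/r. In the second case the conjugates of these to the r points are about |A_l|
unipotents, and sending three of them on distinct points to (w^-1 y, w^-1 z) is at most 2-to-1.
*)

theory Submission
  imports Defs "HOL-Computational_Algebra.Primes"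
begin

text \<open>Lengths inside SL_2(p) do not involve n, so n enters only through the length of t',
  which becomes the unit of length there. For t', both phi(g d) and phi(g^-1 d) must be nonzero for
  one and the same g. Their product is not additive in g, but it is additive in the matrix D between
  g^-1 and g, and this permits counting. The exponent 3/2 has its origin in triples (w, y, z) of
  unipotents: about |A_l|^3 of them are mapped to at most |A_(92 l)|^2 pairs. Fibres are bounded
  because a left translation k between two triples satisfies three linear trace equations and det k
  = 1. The trace argument divides by 2, hence the prime 2 is treated apart. The pivot plays the part
  of a sum-product estimate. For general sets the sums s + g may coincide too often, for instance
  when both sets are intervals, and mixing multiplication by torus parts with addition of unipotent
  parts avoids this.\<close>

section \<open>Collisions and pivots modulo a prime\<close>

text \<open>A fibre with m points supplies m(m - 1) ordered pairs, which is at least 2(m - 1). In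
  the induction a point whose value is already taken brings two ordered pairs.\<close>

lemma twice_card_le_image_collisions:
  assumes "finite Z"
  shows "2 * card Z \<le> 2 * card (f ` Z) + card {(x, y). x \<in> Z \<and> y \<in> Z \<and> x \<noteq> y \<and> f x = f y}"
  using assms
proof (induction Z)
  case empty
  then show ?case by simp
next
  case (insert z Z)
  let ?coll = "\<lambda>Z. {(x, y). x \<in> Z \<and> y \<in> Z \<and> x \<noteq> y \<and> f x = f y}"
  have fin: "finite (?coll (insert z Z))"
    by (rule finite_subset[of _ "insert z Z \<times> insert z Z"]) (use insert in auto)
  have sub: "?coll Z \<subseteq> ?coll (insert z Z)" by auto
  show ?case
  proof (cases "f z \<in> f ` Z")
    case False
    then have "card (f ` insert z Z) = Suc (card (f ` Z))"
      using insert by simp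
    moreover have "card (?coll Z) \<le> card (?coll (insert z Z))"
      using fin sub by (rule card_mono)
    ultimately show ?thesis using insert by simp
  next
    case True
    then obtain w where w: "w \<in> Z" "f w = f z" by auto
    have "insert (z, w) (insert (w, z) (?coll Z)) \<subseteq> ?coll (insert z Z)"
      using w insert by auto
    then have "card (insert (z, w) (insert (w, z) (?coll Z))) \<le> card (?coll (insert z Z))"
      using fin by (rule card_mono[rotated])
    moreover have "card (insert (z, w) (insert (w, z) (?coll Z))) = card (?coll Z) + 2"
    proof -
      have "finite (?coll Z)" using fin sub by (rule finite_subset[rotated])
      moreover have "(w, z) \<notin> ?coll Z" "(z, w) \<notin> ?coll Z" "(z, w) \<noteq> (w, z)"
        using w insert by auto
      ultimately show ?thesis by simp
    qed
    moreover have "f ` insert z Z = f ` Z" using True by auto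
    ultimately show ?thesis using insert by simp
  qed
qed

lemma card_le_twice_image:
  assumes fin: "finite T"
    and two: "\<And>x y z. \<lbrakk>x \<in> T; y \<in> T; z \<in> T; f x = f y; f y = f z\<rbrakk> \<Longrightarrow> x = y \<or> y = z \<or> x = z"
  shows "card T \<le> 2 * card (f ` T)"
proof -
  have "card {x \<in> T. f x = v} \<le> 2" for v
  proof (rule ccontr)
    assume "\<not> ?thesis"
    then have "3 \<le> card {x \<in> T. f x = v}" by simp
    then obtain U where U: "U \<subseteq> {x \<in> T. f x = v}" "card U = 3"
      using obtain_subset_with_card_n by metis
    then obtain x y z where "U = {x, y, z}" "x \<noteq> y" "y \<noteq> z" "x \<noteq> z"
      by (auto simp: card_3_iff)
    then show False using U(1) two[of x y z] by auto
  qed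
  then have "(\<Sum>v\<in>f ` T. card {x \<in> T. f x = v}) \<le> (\<Sum>v\<in>f ` T. 2)" by (rule sum_mono)
  moreover have "card T = (\<Sum>v\<in>f ` T. card {x \<in> T. f x = v})"
    using sum.image_gen[OF fin, of "\<lambda>_. 1::nat" f] by simp
  ultimately show ?thesis by simp
qed

lemma eq_if_dvd_diff:
  fixes x y p :: int
  assumes "p dvd x - y" "x \<in> {0..<p}" "y \<in> {0..<p}"
  shows "x = y"
  using assms by (metis atLeastLessThan_iff mod_eq_dvd_iff mod_pos_pos_trivial)

lemma prime_int_dvd_multD:
  fixes p a b :: int
  assumes "prime p" "p dvd a * b" "\<not> p dvd a"
  shows "p dvd b"
  using assms prime_dvd_multD by blast

lemma inj_on_mult_mod:
  fixes p c :: int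
  assumes "prime p" "\<not> p dvd c"
  shows "inj_on (\<lambda>v. (c * v) mod p) {0..<p}"
proof (rule inj_onI)
  fix x y assume xy: "x \<in> {0..<p}" "y \<in> {0..<p}" and "(c * x) mod p = (c * y) mod p"
  then have "p dvd c * (x - y)" by (simp add: mod_eq_dvd_iff right_diff_distrib)
  then show "x = y" using prime_int_dvd_multD[OF assms(1) _ assms(2)] eq_if_dvd_diff xy by blast
qed

text \<open>After division by \<open>\<delta>\<close>, a collision between \<open>(s, a)\<close> and
  \<open>(t, b)\<close> reads \<open>(a - b) * \<xi> = t - s\<close> modulo \<open>p\<close>. If
  \<open>a\<close> and \<open>b\<close> differ, this makes \<open>\<xi>\<close> a quotient of
  differences; if they agree, so do \<open>s\<close> and \<open>t\<close>.\<close>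

lemma pivot_inj_on:
  fixes p :: int
  assumes p: "prime p" and S: "S \<subseteq> {0..<p}" and G: "G \<subseteq> {0..<p}"
    and \<delta>: "\<not> p dvd \<delta>" and \<eta>: "p dvd \<eta> - \<delta> * \<xi>"
    and \<xi>: "\<And>a b s t. \<lbrakk>a \<in> G; b \<in> G; s \<in> S; t \<in> S; a \<noteq> b\<rbrakk> \<Longrightarrow> \<not> p dvd (a - b) * \<xi> - (s - t)"
  shows "inj_on (\<lambda>(s, g). (\<delta> * s + g * \<eta>) mod p) (S \<times> G)"
proof (rule inj_onI, clarify)
  fix s a t b
  assume st: "s \<in> S" "a \<in> G" "t \<in> S" "b \<in> G"
    and eq: "(\<delta> * s + a * \<eta>) mod p = (\<delta> * t + b * \<eta>) mod p"
  have "p dvd (\<delta> * s + a * \<eta>) - (\<delta> * t + b * \<eta>)"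
    using eq by (simp add: mod_eq_dvd_iff)
  then have "p dvd ((\<delta> * s + a * \<eta>) - (\<delta> * t + b * \<eta>)) - (a - b) * (\<eta> - \<delta> * \<xi>)"
    using \<eta> by (rule dvd_diff[OF _ dvd_mult])
  also have "((\<delta> * s + a * \<eta>) - (\<delta> * t + b * \<eta>)) - (a - b) * (\<eta> - \<delta> * \<xi>)
      = \<delta> * ((a - b) * \<xi> - (t - s))" by (simp add: algebra_simps)
  finally have d: "p dvd (a - b) * \<xi> - (t - s)"
    using p \<delta> prime_int_dvd_multD by blast
  then have "a = b" using \<xi> st by blast
  then have "p dvd s - t" using d by simp
  then have "s = t" using st S eq_if_dvd_diff by blast
  then show "s = t \<and> a = b" using \<open>a = b\<close> by simp
qed

text \<open>The proof averages over all \<open>\<xi>\<close>. Two distinct points collide for at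
  most one of them: subtracting the equations for two values gives \<open>a = b\<close>, and then
  \<open>s = t\<close>.\<close>

lemma pivot_collision:
  fixes p :: int
  assumes p: "prime p" and S: "S \<subseteq> {0..<p}" and G: "G \<subseteq> {0..<p}"
  shows "\<exists>\<xi>. min (card S * card G) (nat p) \<le> 2 * card ((\<lambda>(s, g). (s + g * \<xi>) mod p) ` (S \<times> G))"
proof -
  have fin: "finite S" "finite G" using S G finite_subset by blast+
  \<comment> \<open>At most \<open>p\<close> points are kept, so that the mean number of ordered
    collisions, at most |Z|^2 / p, does not exceed |Z|.\<close>
  obtain Z where Z: "Z \<subseteq> S \<times> G" "card Z = min (card S * card G) (nat p)"
    using obtain_subset_with_card_n[of "min (card S * card G) (nat p)" "S \<times> G"]
    by (auto simp: card_cartesian_product)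
  have finZ: "finite Z" using Z fin finite_subset by blast
  define f where "f \<xi> = (\<lambda>(s, g). (s + g * \<xi>) mod p)" for \<xi> :: int
  define coll where "coll \<xi> = {(x, y). x \<in> Z \<and> y \<in> Z \<and> x \<noteq> y \<and> f \<xi> x = f \<xi> y}" for \<xi>
  have collZ: "coll \<xi> \<subseteq> Z \<times> Z" for \<xi> unfolding coll_def by auto
  have fincoll: "finite (coll \<xi>)" for \<xi>
    using collZ finZ finite_subset by blast
  have disj: "coll \<xi> \<inter> coll \<zeta> = {}" if ne: "\<xi> \<noteq> \<zeta>" and \<xi>: "\<xi> \<in> {0..<p}" and \<zeta>: "\<zeta> \<in> {0..<p}" for \<xi> \<zeta>
  proof (rule ccontr)
    assume "\<not> ?thesis"
    then obtain s a t b where st: "(s, a) \<in> Z" "(t, b) \<in> Z" "(s, a) \<noteq> (t, b)"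
      and eq: "f \<xi> (s, a) = f \<xi> (t, b)" "f \<zeta> (s, a) = f \<zeta> (t, b)"
      unfolding coll_def by auto
    have d: "p dvd (s + a * \<xi>) - (t + b * \<xi>)" "p dvd (s + a * \<zeta>) - (t + b * \<zeta>)"
      using eq by (auto simp: f_def mod_eq_dvd_iff)
    have "p dvd ((s + a * \<xi>) - (t + b * \<xi>)) - ((s + a * \<zeta>) - (t + b * \<zeta>))"
      using d by (rule dvd_diff)
    also have "\<dots> = (\<xi> - \<zeta>) * (a - b)" by (simp add: algebra_simps)
    finally have "p dvd a - b"
      using p ne \<xi> \<zeta> eq_if_dvd_diff prime_int_dvd_multD by blast
    then have ab: "a = b" using st Z G eq_if_dvd_diff by (meson SigmaD2 subsetD)
    then have "p dvd s - t" using d(1) by simp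
    then have "s = t" using st Z S eq_if_dvd_diff by (meson SigmaD1 subsetD)
    then show False using ab st by simp
  qed
  have "(\<Sum>\<xi>\<in>{0..<p}. card (coll \<xi>)) = card (\<Union>\<xi>\<in>{0..<p}. coll \<xi>)"
    by (rule card_UN_disjoint[symmetric]) (use disj fincoll in auto)
  also have "\<dots> \<le> card (Z \<times> Z)"
    by (rule card_mono) (use collZ finZ in auto)
  also have "\<dots> = card Z * card Z" by (simp add: card_cartesian_product)
  also have "\<dots> \<le> nat p * card Z" using Z(2) by simp
  finally have le: "(\<Sum>\<xi>\<in>{0..<p}. card (coll \<xi>)) \<le> nat p * card Z" .
  have "\<exists>\<xi>\<in>{0..<p}. card (coll \<xi>) \<le> card Z"
  proof (rule ccontr)
    assume "\<not> ?thesis"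
    then have "(\<Sum>\<xi>\<in>{0..<p}. card (coll \<xi>)) > (\<Sum>\<xi>\<in>{0..<p}. card Z)"
      using prime_gt_0_int[OF p] by (intro sum_strict_mono) (auto simp: not_le)
    then show False using le by simp
  qed
  then obtain \<xi> where \<xi>: "card (coll \<xi>) \<le> card Z" by auto
  have "2 * card Z \<le> 2 * card (f \<xi> ` Z) + card Z"
    using twice_card_le_image_collisions[OF finZ, of "f \<xi>"] \<xi> unfolding coll_def by linarith
  also have "card (f \<xi> ` Z) \<le> card (f \<xi> ` (S \<times> G))"
    using Z fin by (intro card_mono image_mono) auto
  finally show ?thesis using Z(2) unfolding f_def by (intro exI[of _ \<xi>]) simp
qed

text \<open>The multiplier is a pivot \<open>\<xi>\<close> making \<open>s + g \<xi>\<close> injective or nearly so, scaled by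
  \<open>\<delta> = a - b\<close>, so that \<open>\<eta> = \<delta> \<xi>\<close> is a short expression in elements of \<open>S\<close> and \<open>G\<close>. If some
  multipliers are not quotients \<open>(s - t) / (a - b)\<close>, take \<open>\<xi> + 1\<close> to be one that directly follows
  a quotient \<open>\<xi>\<close>; if all of them are quotients, take one with few collisions.\<close>
lemma pivot:
  fixes p :: int
  assumes p: "prime p" and S: "S \<subseteq> {0..<p}" and G: "G \<subseteq> {0..<p}"
  obtains "min (card S * card G) (nat p) \<le> 2 * card ((\<lambda>(s, g). (s + g) mod p) ` (S \<times> G))"
  | a b s t \<eta> where "a \<in> G" "b \<in> G" "s \<in> S" "t \<in> S" "\<eta> = s - t \<or> \<eta> = s - t + a - b"
    "min (card S * card G) (nat p) \<le> 2 * card ((\<lambda>(s, g). ((a - b) * s + g * \<eta>) mod p) ` (S \<times> G))"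
proof -
  let ?M = "min (card S * card G) (nat p)"
  define Q where "Q \<xi> \<longleftrightarrow> (\<exists>a\<in>G. \<exists>b\<in>G. \<exists>s\<in>S. \<exists>t\<in>S. a \<noteq> b \<and> p dvd (a - b) * \<xi> - (s - t))" for \<xi>
  have inj: "?M \<le> 2 * card ((\<lambda>(s, g). (\<delta> * s + g * \<eta>) mod p) ` (S \<times> G))"
    if "\<not> Q \<xi>" "\<not> p dvd \<delta>" "p dvd \<eta> - \<delta> * \<xi>" for \<xi> \<delta> \<eta>
  proof -
    have "inj_on (\<lambda>(s, g). (\<delta> * s + g * \<eta>) mod p) (S \<times> G)"
      by (rule pivot_inj_on[OF p S G that(2,3)]) (use that(1) in \<open>auto simp: Q_def\<close>)
    then show ?thesis by (simp add: card_image card_cartesian_product)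
  qed
  have npdvd1: "\<not> p dvd 1" using p not_prime_unit by blast
  have ndvd: "\<not> p dvd a - b" if "a \<in> G" "b \<in> G" "a \<noteq> b" for a b
    using that G eq_if_dvd_diff by blast
  show thesis
  proof (cases "Q 1")
    case False
    from inj[OF this npdvd1, of 1] show thesis by (intro that(1)) simp
  next
    case Q1: True
    show thesis
    proof (cases "\<exists>\<xi>. Q \<xi> \<and> \<not> Q (\<xi> + 1)")
      case True
      then obtain \<xi> where "Q \<xi>" and nQ: "\<not> Q (\<xi> + 1)" by blast
      then obtain a b s t where abst: "a \<in> G" "b \<in> G" "s \<in> S" "t \<in> S" "a \<noteq> b"
        and d: "p dvd (a - b) * \<xi> - (s - t)" unfolding Q_def by blast
      have "p dvd - ((a - b) * \<xi> - (s - t))" using d by (simp only: dvd_minus_iff)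
      also have "- ((a - b) * \<xi> - (s - t)) = (s - t + a - b) - (a - b) * (\<xi> + 1)"
        by (simp add: algebra_simps)
      finally have "?M \<le> 2 * card ((\<lambda>(u, g). ((a - b) * u + g * (s - t + a - b)) mod p) ` (S \<times> G))"
        using inj[OF nQ ndvd] abst by blast
      then show thesis using that(2) abst by blast
    next
      case False
      \<comment> \<open>Starting from 1, adding 1 never leaves the set of quotients, so every
        residue class is reached.\<close>
      have Qn: "Q (1 + int n)" for n
        by (induction n) (use Q1 False in \<open>auto simp: add.assoc[symmetric] add.commute\<close>)
      obtain \<xi> where \<xi>: "?M \<le> 2 * card ((\<lambda>(s, g). (s + g * \<xi>) mod p) ` (S \<times> G))"
        using pivot_collision[OF p S G] by blast
      have p1: "p > 1" using p prime_gt_1_int by blast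
      obtain n where n: "p dvd (1 + int n) - \<xi>"
      proof
        show "p dvd (1 + int (nat ((\<xi> - 1) mod p))) - \<xi>"
          using p1 by (simp add: mod_eq_dvd_iff[symmetric] mod_simps)
      qed
      from Qn[of n] obtain a b s t where abst: "a \<in> G" "b \<in> G" "s \<in> S" "t \<in> S" "a \<noteq> b"
        and d: "p dvd (a - b) * (1 + int n) - (s - t)" unfolding Q_def by blast
      have "p dvd ((a - b) * (1 + int n) - (s - t)) - (a - b) * ((1 + int n) - \<xi>)"
        using d n by (rule dvd_diff[OF _ dvd_mult])
      then have d': "p dvd (a - b) * \<xi> - (s - t)" by (simp add: algebra_simps)
      let ?f = "\<lambda>(u, g). (u + g * \<xi>) mod p" and ?g = "\<lambda>(u, g). ((a - b) * u + g * (s - t)) mod p"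
      have "?f ` (S \<times> G) \<subseteq> {0..<p}" using p1 by auto
      then have "inj_on (\<lambda>v. ((a - b) * v) mod p) (?f ` (S \<times> G))"
        using inj_on_mult_mod[OF p ndvd[OF abst(1,2,5)]] inj_on_subset by blast
      then have "card (?f ` (S \<times> G)) = card ((\<lambda>v. ((a - b) * v) mod p) ` ?f ` (S \<times> G))"
        by (simp add: card_image)
      also have "(\<lambda>v. ((a - b) * v) mod p) ` ?f ` (S \<times> G) = ?g ` (S \<times> G)"
        unfolding image_image
      proof (rule image_cong[OF refl], clarify)
        fix u g
        have "((a - b) * ((u + g * \<xi>) mod p)) mod p = ((a - b) * (u + g * \<xi>)) mod p"
          by (simp add: mod_simps)
        also have "\<dots> = ((a - b) * u + g * (s - t)) mod p"
        proof -
          have "p dvd g * ((a - b) * \<xi> - (s - t))" using d' by (rule dvd_mult)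
          then show ?thesis unfolding mod_eq_dvd_iff by (simp add: algebra_simps)
        qed
        finally show "(a - b) * ((u + g * \<xi>) mod p) mod p = ((a - b) * u + g * (s - t)) mod p" .
      qed
      finally have "?M \<le> 2 * card (?g ` (S \<times> G))" using \<xi> by simp
      then show thesis using that(2) abst by blast
    qed
  qed
qed

section \<open>Two-by-two matrices\<close>

text \<open>Matrices are integer quadruples that are read modulo \<open>p\<close> but not reduced. Accordingly \<open>qinv\<close>
  (the adjugate) is an inverse only modulo \<open>p\<close> and for determinant 1. The value \<open>qwedge q r\<close> vanishes
  iff the first columns are proportional, that is, iff \<open>q\<close> and \<open>r\<close> move infinity to the same point of the
  projective line; \<open>qunip q s\<close> is the conjugate by \<open>q\<close> of \<open>(1, s, 0, 1)\<close>.\<close>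
type_synonym quad = "int \<times> int \<times> int \<times> int"

fun qmul :: "quad \<Rightarrow> quad \<Rightarrow> quad" where
  "qmul (a, b, c, d) (a', b', c', d') = (a*a' + b*c', a*b' + b*d', c*a' + d*c', c*b' + d*d')"

fun qinv :: "quad \<Rightarrow> quad" where
  "qinv (a, b, c, d) = (d, -b, -c, a)"

fun qdet :: "quad \<Rightarrow> int" where
  "qdet (a, b, c, d) = a*d - b*c"

fun qmod :: "int \<Rightarrow> quad \<Rightarrow> quad" where
  "qmod p (a, b, c, d) = (a mod p, b mod p, c mod p, d mod p)"

fun qtrace :: "quad \<Rightarrow> int" where
  "qtrace (a, b, c, d) = a + d"

fun qwedge :: "quad \<Rightarrow> quad \<Rightarrow> int" where
  "qwedge (a, b, c, d) (a', b', c', d') = a*c' - c*a'"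

fun qunip :: "quad \<Rightarrow> int \<Rightarrow> quad" where
  "qunip (a, b, c, d) s = (1 - s*a*c, s*a\<^sup>2, -s*c\<^sup>2, 1 + s*a*c)"

lemma qmul_assoc: "qmul (qmul q r) s = qmul q (qmul r s)"
  by (cases q; cases r; cases s) (simp add: algebra_simps)

lemma qmul_one [simp]: "qmul (1, 0, 0, 1) q = q" "qmul q (1, 0, 0, 1) = q"
  by (cases q; simp)+

lemma qmod_qmod [simp]: "qmod p (qmod p q) = qmod p q"
  by (cases q) simp

lemma qmod_qmul_left: "qmod p (qmul (qmod p q) r) = qmod p (qmul q r)"
  by (cases q; cases r) (auto intro!: mod_add_cong mod_mult_cong)

lemma qmod_qmul_right: "qmod p (qmul q (qmod p r)) = qmod p (qmul q r)"
  by (cases q; cases r) (auto intro!: mod_add_cong mod_mult_cong)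

lemma qmod_qmul_cong:
  "qmod p q = qmod p q' \<Longrightarrow> qmod p r = qmod p r' \<Longrightarrow> qmod p (qmul q r) = qmod p (qmul q' r')"
  by (metis qmod_qmul_left qmod_qmul_right)

lemma qmod_qinv:
  assumes "p dvd qdet q - 1"
  shows "qmod p (qmul q (qinv q)) = qmod p (1, 0, 0, 1)" "qmod p (qmul (qinv q) q) = qmod p (1, 0, 0, 1)"
  using assms by (cases q, simp add: mod_eq_dvd_iff algebra_simps)+

lemma qmod_qmul_qinv_cancel:
  assumes "p dvd qdet q - 1"
  shows "qmod p (qmul q (qmul (qinv q) r)) = qmod p r" "qmod p (qmul (qinv q) (qmul q r)) = qmod p r"
  unfolding qmul_assoc[symmetric] using qmod_qinv[OF assms] qmod_qmul_cong[of p _ "(1,0,0,1)" r r] by auto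

lemma qunip_conj:
  assumes "p dvd qdet q - 1"
  shows "qmod p (qmul (qmul q (1, s, 0, 1)) (qinv q)) = qmod p (qunip q s)"
proof (cases q)
  case (fields a b c d)
  have *: "p dvd a * d - b * c - 1" using assms fields by simp
  have "(a * d + (a * s + b) * - c) - (1 - s * a * c) = a * d - b * c - 1"
    "(c * (- b) + (c * s + d) * a) - (1 + s * a * c) = a * d - b * c - 1"
    by (simp_all add: algebra_simps)
  then show ?thesis using * fields
    by (simp add: mod_eq_dvd_iff algebra_simps power2_eq_square)
qed

text \<open>A nonzero binary quadratic form has at most two zeros on the projective line.
  \<open>?V\<close> is the determinant of the linear system for \<open>u\<close>, \<open>v\<close>,
  \<open>w\<close>, a homogeneous Vandermonde product, and the three identities are Cramer's
  rule.\<close>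

lemma quadratic_form_zero:
  fixes p :: int
  assumes p: "prime p"
    and "\<not> p dvd a1*c2 - c1*a2" "\<not> p dvd a1*c3 - c1*a3" "\<not> p dvd a2*c3 - c2*a3"
    and e: "p dvd u*a1\<^sup>2 + v*(a1*c1) + w*c1\<^sup>2" "p dvd u*a2\<^sup>2 + v*(a2*c2) + w*c2\<^sup>2"
      "p dvd u*a3\<^sup>2 + v*(a3*c3) + w*c3\<^sup>2"
  shows "p dvd u" "p dvd v" "p dvd w"
proof -
  let ?V = "(a1*c2 - c1*a2) * (a1*c3 - c1*a3) * (a2*c3 - c2*a3)"
  have V: "\<not> p dvd ?V" using assms(2-4) p prime_dvd_mult_iff by blast
  let ?e = "\<lambda>a c. u*a\<^sup>2 + v*(a*c) + w*c\<^sup>2"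
  have lin: "p dvd x * ?e a1 c1 + y * ?e a2 c2 + z * ?e a3 c3" for x y z
    by (rule dvd_add[OF dvd_add[OF dvd_mult[OF e(1)] dvd_mult[OF e(2)]] dvd_mult[OF e(3)]])
  have "?V * u = (c2*c3*(a2*c3 - c2*a3)) * ?e a1 c1 + (- c1*c3*(a1*c3 - c1*a3)) * ?e a2 c2
      + (c1*c2*(a1*c2 - c1*a2)) * ?e a3 c3"
    by (simp add: algebra_simps power2_eq_square)
  then show "p dvd u" using lin V prime_int_dvd_multD[OF p] by metis
  have "?V * v = (- (a2*c3 - c2*a3)*(a2*c3 + c2*a3)) * ?e a1 c1
      + ((a1*c3 - c1*a3)*(a1*c3 + c1*a3)) * ?e a2 c2
      + (- (a1*c2 - c1*a2)*(a1*c2 + c1*a2)) * ?e a3 c3"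
    by (simp add: algebra_simps power2_eq_square)
  then show "p dvd v" using lin V prime_int_dvd_multD[OF p] by metis
  have "?V * w = (a2*a3*(a2*c3 - c2*a3)) * ?e a1 c1 + (- a1*a3*(a1*c3 - c1*a3)) * ?e a2 c2
      + (a1*a2*(a1*c2 - c1*a2)) * ?e a3 c3"
    by (simp add: algebra_simps power2_eq_square)
  then show "p dvd w" using lin V prime_int_dvd_multD[OF p] by metis
qed

text \<open>The three hypotheses on \<open>D = (d1, d2, d3, d4)\<close> say \<open>tr (D w) = 0\<close> for the unipotents \<open>w\<close>
  fixing the vectors \<open>(a, c)\<close>. If \<open>tr D = 0\<close>, these vectors are eigenvectors of \<open>D\<close>, and a matrix with
  three eigenlines is scalar.\<close>
lemma trace_zero_eigenlines:
  fixes p :: int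
  assumes p: "prime p" "p \<noteq> 2"
    and lines: "\<not> p dvd a1*c2 - c1*a2" "\<not> p dvd a1*c3 - c1*a3" "\<not> p dvd a2*c3 - c2*a3"
    and s: "\<not> p dvd s1" "\<not> p dvd s2" "\<not> p dvd s3"
    and T: "p dvd d1 + d4"
    and e: "p dvd (d1 + d4) + s1 * (d3*a1\<^sup>2 + (d4 - d1)*(a1*c1) + (- d2)*c1\<^sup>2)"
      "p dvd (d1 + d4) + s2 * (d3*a2\<^sup>2 + (d4 - d1)*(a2*c2) + (- d2)*c2\<^sup>2)"
      "p dvd (d1 + d4) + s3 * (d3*a3\<^sup>2 + (d4 - d1)*(a3*c3) + (- d2)*c3\<^sup>2)"
  shows "p dvd d1" "p dvd d2" "p dvd d3" "p dvd d4"
proof -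
  have Q: "p dvd d3*a1\<^sup>2 + (d4 - d1)*(a1*c1) + (- d2)*c1\<^sup>2"
    "p dvd d3*a2\<^sup>2 + (d4 - d1)*(a2*c2) + (- d2)*c2\<^sup>2"
    "p dvd d3*a3\<^sup>2 + (d4 - d1)*(a3*c3) + (- d2)*c3\<^sup>2"
    using e T s prime_int_dvd_multD[OF p(1)] dvd_add_right_iff by metis+
  note z = quadratic_form_zero[OF p(1) lines Q]
  show "p dvd d3" using z by simp
  show "p dvd d2" using z by simp
  \<comment> \<open>\<open>D\<close> is now known to be scalar with trace zero, and for odd
    \<open>p\<close> such a matrix vanishes.\<close>
  have "p dvd (d1 + d4) + (d4 - d1)" using T z(2) by (rule dvd_add)
  then have "p dvd 2 * d4" by (simp add: algebra_simps)
  moreover have "\<not> p dvd 2"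
    using p primes_dvd_imp_eq[of p 2] by auto
  ultimately show "p dvd d4" using p(1) prime_int_dvd_multD by blast
  then show "p dvd d1" using T by (simp add: dvd_add_left_iff)
qed

text \<open>By the previous lemma solutions are determined by their trace \<open>T\<close>, so \<open>D = T D\<^sub>0\<close>, and
  \<open>det (1 + D) = 1\<close> reads \<open>T + T\<^sup>2 det D\<^sub>0 = 0\<close>, which has only one nonzero root.\<close>
lemma proportional_solutions:
  fixes p :: int
  assumes p: "prime p" "p \<noteq> 2"
    and lines: "\<not> p dvd a1*c2 - c1*a2" "\<not> p dvd a1*c3 - c1*a3" "\<not> p dvd a2*c3 - c2*a3"
    and s: "\<not> p dvd s1" "\<not> p dvd s2" "\<not> p dvd s3"
    and e: "p dvd (d1 + d4) + s1 * (d3*a1\<^sup>2 + (d4 - d1)*(a1*c1) + (- d2)*c1\<^sup>2)"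
      "p dvd (d1 + d4) + s2 * (d3*a2\<^sup>2 + (d4 - d1)*(a2*c2) + (- d2)*c2\<^sup>2)"
      "p dvd (d1 + d4) + s3 * (d3*a3\<^sup>2 + (d4 - d1)*(a3*c3) + (- d2)*c3\<^sup>2)"
    and e': "p dvd (d1' + d4') + s1 * (d3'*a1\<^sup>2 + (d4' - d1')*(a1*c1) + (- d2')*c1\<^sup>2)"
      "p dvd (d1' + d4') + s2 * (d3'*a2\<^sup>2 + (d4' - d1')*(a2*c2) + (- d2')*c2\<^sup>2)"
      "p dvd (d1' + d4') + s3 * (d3'*a3\<^sup>2 + (d4' - d1')*(a3*c3) + (- d2')*c3\<^sup>2)"
    and det: "p dvd (d1 + d4) + (d1*d4 - d2*d3)" "p dvd (d1' + d4') + (d1'*d4' - d2'*d3')"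
    and nz: "\<not> (p dvd d1 \<and> p dvd d2 \<and> p dvd d3 \<and> p dvd d4)"
      "\<not> (p dvd d1' \<and> p dvd d2' \<and> p dvd d3' \<and> p dvd d4')"
  shows "p dvd d1 - d1' \<and> p dvd d2 - d2' \<and> p dvd d3 - d3' \<and> p dvd d4 - d4'"
proof -
  define T T' where "T = d1 + d4" and "T' = d1' + d4'"
  have T: "\<not> p dvd T" "\<not> p dvd T'"
    using trace_zero_eigenlines[OF p lines s _ e] trace_zero_eigenlines[OF p lines s _ e'] nz
    unfolding T_def T'_def by blast+
  \<comment> \<open>The combination T' D - T D' solves the same linear equations and has trace zero,
    so it vanishes.\<close>
  let ?D1 = "T'*d1 - T*d1'" and ?D2 = "T'*d2 - T*d2'" and ?D3 = "T'*d3 - T*d3'" and ?D4 = "T'*d4 - T*d4'"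
  have comb: "p dvd (?D1 + ?D4) + s * (?D3*a\<^sup>2 + (?D4 - ?D1)*(a*c) + (- ?D2)*c\<^sup>2)"
    if "p dvd (d1 + d4) + s * (d3*a\<^sup>2 + (d4 - d1)*(a*c) + (- d2)*c\<^sup>2)"
      "p dvd (d1' + d4') + s * (d3'*a\<^sup>2 + (d4' - d1')*(a*c) + (- d2')*c\<^sup>2)" for a c s
  proof -
    have "p dvd T' * ((d1 + d4) + s * (d3*a\<^sup>2 + (d4 - d1)*(a*c) + (- d2)*c\<^sup>2))
       - T * ((d1' + d4') + s * (d3'*a\<^sup>2 + (d4' - d1')*(a*c) + (- d2')*c\<^sup>2))"
      using that by (intro dvd_diff[OF dvd_mult dvd_mult])
    then show ?thesis by (simp add: algebra_simps)
  qed
  have "p dvd ?D1 + ?D4" unfolding T_def T'_def by (simp add: algebra_simps)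
  from trace_zero_eigenlines[OF p lines s this comb[OF e(1) e'(1)] comb[OF e(2) e'(2)] comb[OF e(3) e'(3)]]
  have D: "p dvd ?D1" "p dvd ?D2" "p dvd ?D3" "p dvd ?D4" .
  \<comment> \<open>By proportionality T'^2 det D = T^2 det D' modulo \<open>p\<close>, so combining
    the two determinant conditions leaves T T' (T' - T).\<close>
  have "T * T' * (T' - T) = T'\<^sup>2 * (T + (d1*d4 - d2*d3)) - T\<^sup>2 * (T' + (d1'*d4' - d2'*d3'))
     - (T' * d4 * ?D1 + T * d1' * ?D4 - T' * d3 * ?D2 - T * d2' * ?D3)"
    by (simp add: algebra_simps power2_eq_square)
  also have "p dvd \<dots>"
    using D det unfolding T_def[symmetric] T'_def[symmetric]
    by (intro dvd_diff[OF dvd_diff[OF dvd_mult dvd_mult] dvd_diff[OF dvd_diff[OF dvd_add[OF dvd_mult dvd_mult] dvd_mult] dvd_mult]])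
  finally have TT: "p dvd T' - T" using T prime_int_dvd_multD[OF p(1)] by blast
  have "p dvd d - d'" if "p dvd T'*d - T*d'" for d d'
  proof -
    have "T * (d - d') = (T'*d - T*d') - d * (T' - T)" by (simp add: algebra_simps)
    also have "p dvd \<dots>" using that TT by (rule dvd_diff[OF _ dvd_mult])
    finally show ?thesis using T prime_int_dvd_multD[OF p(1)] by blast
  qed
  then show ?thesis using D by blast
qed

section \<open>Growth in filtrations of the special linear group of degree two\<close>

text \<open>Word length in SL_2(p), axiomatised. The entry \<open>x\<close> stays arbitrary because
  the product of the off-diagonal entries of the two unipotents survives every rescaling of the
  basis, so only one of them can be normalised to 1.\<close>

locale sl2_filtration =
  fixes p :: int and A :: "nat \<Rightarrow> quad set" and x :: int
  assumes prime: "prime p" and odd: "p \<noteq> 2"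
    and det: "q \<in> A l \<Longrightarrow> p dvd qdet q - 1"
    and one: "(1, 0, 0, 1) \<in> A l"
    and mul: "q \<in> A l \<Longrightarrow> r \<in> A m \<Longrightarrow> qmul q r \<in> A (l + m)"
    and inv: "q \<in> A l \<Longrightarrow> qinv q \<in> A l"
    and cong: "q \<in> A l \<Longrightarrow> qmod p q = qmod p r \<Longrightarrow> r \<in> A l"
    and upper: "(1, 1, 0, 1) \<in> A 1"
    and lower: "(1, 0, x, 1) \<in> A 1" "\<not> p dvd x"
begin

lemma mono: "l \<le> m \<Longrightarrow> A l \<subseteq> A m"
  using mul[OF _ one, of _ l "m - l"] by auto

lemma p_gt_2: "p > 2"
  using prime_ge_2_int[OF prime] odd by linarith

text \<open>By \<open>cong\<close> each \<open>A l\<close> is a union of residue classes; the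
  reduced representatives make it countable as a subset of SL_2(p).\<close>

definition box :: "nat \<Rightarrow> quad set" where
  "box l = A l \<inter> {0..<p} \<times> {0..<p} \<times> {0..<p} \<times> {0..<p}"

lemma finite_box [simp]: "finite (box l)"
  unfolding box_def by simp

lemma box_subset: "box l \<subseteq> A l"
  unfolding box_def by simp

lemma qmod_mem: "q \<in> A l \<Longrightarrow> qmod p q \<in> A l"
  by (erule cong) simp

lemma qmod_mem_box: "q \<in> A l \<Longrightarrow> qmod p q \<in> box l"
  using qmod_mem[of q l] p_gt_2 by (cases q) (simp add: box_def)

lemma qmod_box: "q \<in> box l \<Longrightarrow> qmod p q = q"
  by (cases q) (simp add: box_def)

lemma card_box_le: "card (box l) \<le> nat p ^ 4"
proof -
  have "card (box l) \<le> card ({0..<p} \<times> {0..<p} \<times> {0..<p} \<times> {0..<p})"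
    unfolding box_def by (intro card_mono) auto
  also have "\<dots> = nat p ^ 4" by (simp add: card_cartesian_product power4_eq_xxxx)
  finally show ?thesis .
qed

lemma upper_add: "(1, s, 0, 1) \<in> A l \<Longrightarrow> (1, t, 0, 1) \<in> A m \<Longrightarrow> (1, s + t, 0, 1) \<in> A (l + m)"
  using mul[of "(1, s, 0, 1)" l "(1, t, 0, 1)" m] by (simp add: add.commute)

lemma upper_minus: "(1, s, 0, 1) \<in> A l \<Longrightarrow> (1, - s, 0, 1) \<in> A l"
  using inv[of "(1, s, 0, 1)" l] by simp

lemma upper_diff: "(1, s, 0, 1) \<in> A l \<Longrightarrow> (1, t, 0, 1) \<in> A m \<Longrightarrow> (1, s - t, 0, 1) \<in> A (l + m)"
  using upper_add[OF _ upper_minus, of s l t m] by simp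

lemma upper_cong: "(1, s, 0, 1) \<in> A l \<Longrightarrow> s mod p = t mod p \<Longrightarrow> (1, t, 0, 1) \<in> A l"
  by (erule cong) simp

lemma upper_nat: "(1, int i, 0, 1) \<in> A i"
proof (induction i)
  case 0
  then show ?case using one by simp
next
  case (Suc i)
  then show ?case using upper_add[OF Suc upper] by (simp add: add.commute)
qed

lemma qunip_mem:
  assumes "q \<in> A l" "(1, s, 0, 1) \<in> A m"
  shows "qunip q s \<in> A (2 * l + m)"
proof -
  have "qmul (qmul q (1, s, 0, 1)) (qinv q) \<in> A (l + m + l)"
    by (rule mul[OF mul[OF assms] inv[OF assms(1)]])
  then have "qunip q s \<in> A (l + m + l)"
    by (rule cong) (rule qunip_conj[OF det[OF assms(1)]])
  moreover have "l + m + l = 2 * l + m" by simp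
  ultimately show ?thesis by simp
qed

lemma upper_scale:
  assumes "(a, b, 0, d) \<in> A l" "(1, s, 0, 1) \<in> A m"
  shows "(1, a\<^sup>2 * s, 0, 1) \<in> A (2 * l + m)"
  using qunip_mem[OF assms] by (simp add: mult.commute)

text \<open>An element is determined by its representative and its quotient by that representative.
  This serves once for cosets of the upper triangular group and once for cosets of the upper
  unipotents.\<close>

lemma card_le_cosets:
  assumes X: "X \<subseteq> box l" and r: "\<And>q. q \<in> X \<Longrightarrow> r q \<in> R \<and> p dvd qdet (r q) - 1"
    and Y: "\<And>q. q \<in> X \<Longrightarrow> qmod p (qmul (qinv (r q)) q) \<in> Y"
    and fin: "finite R" "finite Y"
  shows "card X \<le> card R * card Y"
proof -
  let ?h = "\<lambda>q. (r q, qmod p (qmul (qinv (r q)) q))"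
  have "inj_on ?h X"
  proof (rule inj_onI)
    fix q q' assume q: "q \<in> X" "q' \<in> X" and eq: "?h q = ?h q'"
    have rq: "r q' = r q" using eq by simp
    have "qmod p (qmul (qinv (r q)) q) = qmod p (qmul (qinv (r q)) q')"
      using eq unfolding rq by simp
    then have "qmod p (qmul (r q) (qmul (qinv (r q)) q)) = qmod p (qmul (r q) (qmul (qinv (r q)) q'))"
      using qmod_qmul_cong[OF refl] by blast
    then have "qmod p q = qmod p q'"
      using qmod_qmul_qinv_cancel(1) r[OF q(1)] by simp
    moreover have "q \<in> box l" "q' \<in> box l" using q X by auto
    ultimately show "q = q'" using qmod_box by simp
  qed
  moreover have "?h ` X \<subseteq> R \<times> Y" using r Y by auto
  ultimately have "card X \<le> card (R \<times> Y)"
    using fin by (intro card_inj_on_le[of ?h]) auto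
  then show ?thesis by (simp add: card_cartesian_product)
qed

section \<open>Points of the projective line reached by short elements\<close>

definition separated :: "quad set \<Rightarrow> bool" where
  "separated R \<longleftrightarrow> (\<forall>q\<in>R. \<forall>r\<in>R. q \<noteq> r \<longrightarrow> \<not> p dvd qwedge q r)"

lemma qwedge_cong:
  "qmod p q = qmod p q' \<Longrightarrow> qmod p r = qmod p r' \<Longrightarrow> p dvd qwedge q r \<longleftrightarrow> p dvd qwedge q' r'"
proof -
  assume "qmod p q = qmod p q'" "qmod p r = qmod p r'"
  then have "qwedge q r mod p = qwedge q' r' mod p"
    by (cases q; cases q'; cases r; cases r') (auto intro!: mod_diff_cong mod_mult_cong)
  then show ?thesis by (simp add: dvd_eq_mod_eq_0)
qed

lemma qwedge_sym: "p dvd qwedge q r \<longleftrightarrow> p dvd qwedge r q"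
proof -
  have "qwedge q r = - qwedge r q" by (cases q; cases r) simp
  then show ?thesis by simp
qed

text \<open>A separated set of maximal size represents every point reached from
  \<open>box l\<close>. The three points come from the identity and the lower unipotents with
  entries \<open>x\<close> and \<open>-x\<close>; they are distinct because \<open>p\<close> is
  odd.\<close>

lemma exists_maximal_separated:
  assumes l: "1 \<le> l"
  obtains R where "R \<subseteq> box l" "separated R" "3 \<le> card R"
    "\<And>q. q \<in> box l \<Longrightarrow> \<exists>r\<in>R. p dvd qwedge r q"
proof -
  let ?P = "\<lambda>R. R \<subseteq> box l \<and> separated R"
  let ?m = "\<lambda>y. qmod p (1, 0, y, 1)"
  have "(1, 0, - x, 1) \<in> A 1" using inv[OF lower(1)] by simp
  then have mem: "?m 0 \<in> box l" "?m x \<in> box l" "?m (-x) \<in> box l"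
    using mono[OF l] one[of l] lower(1) qmod_mem_box by blast+
  have w: "p dvd qwedge (?m y) (?m z) \<longleftrightarrow> p dvd z - y" for y z
    using qwedge_cong[of "?m y" "(1, 0, y, 1)" "?m z" "(1, 0, z, 1)"] by simp
  have n2: "\<not> p dvd 2 * x"
  proof
    assume "p dvd 2 * x"
    moreover have "\<not> p dvd 2" using p_gt_2 zdvd_imp_le[of p 2] by linarith
    ultimately show False using prime_int_dvd_multD[OF prime] lower(2) by blast
  qed
  have minus_double: "- x - x = - (2 * x)" by simp
  have nw: "\<not> p dvd qwedge (?m 0) (?m x)" "\<not> p dvd qwedge (?m 0) (?m (-x))"
    "\<not> p dvd qwedge (?m x) (?m (-x))"
    unfolding w minus_double using lower(2) n2 by simp_all
  have self: "p dvd qwedge q q" for q by (cases q) simp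
  have ne: "?m 0 \<noteq> ?m x" "?m 0 \<noteq> ?m (-x)" "?m x \<noteq> ?m (-x)"
    using nw by (auto simp del: qmod.simps simp add: self)
  let ?R3 = "{?m 0, ?m x, ?m (-x)}"
  have sep3: "separated ?R3"
    unfolding separated_def using nw qwedge_sym by blast
  have P3: "?P ?R3" using mem sep3 by blast
  have fin: "finite (Collect ?P)"
    by (rule finite_subset[of _ "Pow (box l)"]) auto
  obtain R where R: "?P R" and max: "\<And>R'. ?P R' \<Longrightarrow> card R' \<le> card R"
  proof -
    have "Max (card ` Collect ?P) \<in> card ` Collect ?P"
      by (rule Max_in) (use fin P3 in blast)+
    then obtain R where "Max (card ` Collect ?P) = card R" "R \<in> Collect ?P" by (rule imageE)
    moreover have "card R' \<le> Max (card ` Collect ?P)" if "?P R'" for R'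
      by (rule Max_ge) (use fin that in blast)+
    ultimately show thesis using that by simp
  qed
  have "card ?R3 = 3" using ne by simp
  then have "3 \<le> card R" using max[OF P3] by simp
  moreover have "\<exists>r\<in>R. p dvd qwedge r q" if q: "q \<in> box l" for q
  proof (rule ccontr)
    assume no: "\<not> ?thesis"
    then have "q \<notin> R" using self by blast
    moreover have "finite R" using R finite_box finite_subset by blast
    moreover have "?P (insert q R)"
      using R q no qwedge_sym unfolding separated_def by blast
    ultimately show False using max[of "insert q R"] by simp
  qed
  ultimately show thesis using that R by blast
qed

lemma card_square_image:
  assumes "X \<subseteq> {0..<p}"
  shows "card X \<le> 2 * card ((\<lambda>a. a\<^sup>2 mod p) ` X)"
proof (rule card_le_twice_image)
  show "finite X" using assms finite_subset by blast
  fix a b c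
  assume abc: "a \<in> X" "b \<in> X" "c \<in> X" "a\<^sup>2 mod p = b\<^sup>2 mod p" "b\<^sup>2 mod p = c\<^sup>2 mod p"
  have sum: "p dvd u + v" if "u \<in> X" "v \<in> X" "u\<^sup>2 mod p = v\<^sup>2 mod p" "u \<noteq> v" for u v
  proof -
    have "p dvd (u - v) * (u + v)"
      using that(3) by (simp add: mod_eq_dvd_iff power2_eq_square algebra_simps)
    moreover have "\<not> p dvd u - v" using that assms eq_if_dvd_diff by blast
    ultimately show ?thesis using prime_int_dvd_multD[OF prime] by blast
  qed
  show "a = b \<or> b = c \<or> a = c"
  proof (rule ccontr)
    assume "\<not> ?thesis"
    then have "p dvd (a + b) - (b + c)"
      using sum abc by (intro dvd_diff[OF sum sum]) auto
    then have "p dvd a - c" by simp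
    then show False using \<open>\<not> _\<close> abc assms eq_if_dvd_diff by blast
  qed
qed

end

section \<open>Traces and translations of unipotents\<close>

lemma qdet_qmul: "qdet (qmul q r) = qdet q * qdet r"
  by (cases q; cases r) (simp add: algebra_simps)

lemma qdet_qinv: "qdet (qinv q) = qdet q"
  by (cases q) (simp add: algebra_simps)

lemma qdet_qunip [simp]: "qdet (qunip q s) = 1"
  by (cases q) (simp add: algebra_simps power2_eq_square)

lemma qtrace_qunip: "qtrace (qunip q s) = 2"
  by (cases q) simp

lemma qtrace_cong:
  assumes "qmod p q = qmod p r"
  shows "p dvd qtrace q - qtrace r"
proof -
  have "qtrace q mod p = qtrace r mod p"
    using assms by (cases q; cases r) (auto intro: mod_add_cong)
  then show ?thesis by (simp add: mod_eq_dvd_iff)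
qed

text \<open>Put k = 1 + D. Unipotents have trace 2, so tr(k w) = 2 means tr(D w) = 0, and
  \<open>proportional_solutions\<close> applies to D. Besides k = 1 there is at most one solution,
  which is what makes the map on triples at most 2-to-1.\<close>

lemma at_most_one_translation:
  fixes p :: int
  assumes p: "prime p" "p \<noteq> 2"
    and lines: "\<not> p dvd qwedge q1 q2" "\<not> p dvd qwedge q1 q3" "\<not> p dvd qwedge q2 q3"
    and s: "\<not> p dvd s1" "\<not> p dvd s2" "\<not> p dvd s3"
    and det: "p dvd qdet k - 1" "p dvd qdet k' - 1"
    and k: "p dvd qtrace (qmul k (qunip q1 s1)) - 2" "p dvd qtrace (qmul k (qunip q2 s2)) - 2"
      "p dvd qtrace (qmul k (qunip q3 s3)) - 2"
    and k': "p dvd qtrace (qmul k' (qunip q1 s1)) - 2" "p dvd qtrace (qmul k' (qunip q2 s2)) - 2"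
      "p dvd qtrace (qmul k' (qunip q3 s3)) - 2"
  shows "qmod p k = qmod p (1, 0, 0, 1) \<or> qmod p k' = qmod p (1, 0, 0, 1) \<or> qmod p k = qmod p k'"
proof -
  obtain a1 b1 c1 d1 where q1: "q1 = (a1, b1, c1, d1)" by (cases q1)
  obtain a2 b2 c2 d2 where q2: "q2 = (a2, b2, c2, d2)" by (cases q2)
  obtain a3 b3 c3 d3 where q3: "q3 = (a3, b3, c3, d3)" by (cases q3)
  obtain e1 e2 e3 e4 where ke: "k = (e1, e2, e3, e4)" by (cases k)
  obtain f1 f2 f3 f4 where kf: "k' = (f1, f2, f3, f4)" by (cases k')
  have tr: "qtrace (qmul (k1, k2, k3, k4) (qunip (a, b, c, d) s)) - 2
      = (k1 - 1 + (k4 - 1)) + s * (k3*a\<^sup>2 + (k4 - 1 - (k1 - 1))*(a*c) + (- k2)*c\<^sup>2)"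
    for k1 k2 k3 k4 a b c d s
    by (simp add: algebra_simps)
  have dt: "qdet (k1, k2, k3, k4) - 1 = (k1 - 1 + (k4 - 1)) + ((k1 - 1) * (k4 - 1) - k2 * k3)"
    for k1 k2 k3 k4 by (simp add: algebra_simps)
  note l = lines[unfolded q1 q2 q3 qwedge.simps]
  note E = k[unfolded q1 q2 q3 ke tr]
  note F = k'[unfolded q1 q2 q3 kf tr]
  note D = det[unfolded ke kf dt]
  from proportional_solutions[OF p l s E F D]
  have "(p dvd e1 - 1 \<and> p dvd e2 \<and> p dvd e3 \<and> p dvd e4 - 1)
    \<or> (p dvd f1 - 1 \<and> p dvd f2 \<and> p dvd f3 \<and> p dvd f4 - 1)
    \<or> (p dvd e1 - 1 - (f1 - 1) \<and> p dvd e2 - f2 \<and> p dvd e3 - f3 \<and> p dvd e4 - 1 - (f4 - 1))"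
    by blast
  then show ?thesis unfolding ke kf by (auto simp: mod_eq_dvd_iff dvd_eq_mod_eq_0)
qed

context sl2_filtration
begin

text \<open>Apart from the identity, \<open>qunip q s\<close> holds the coefficients of the form s(a
  Y - c X)^2. At the first column (a', c') of \<open>r\<close> the form of \<open>qunip r t\<close>
  vanishes, which leaves \<open>s\<close> times the square of \<open>qwedge q r\<close>. The
  parameter is then determined because \<open>a\<close> and \<open>c\<close> are not both 0.\<close>

lemma qunip_inj:
  assumes det: "p dvd qdet q - 1" and s: "\<not> p dvd s"
    and eq: "qmod p (qunip q s) = qmod p (qunip r t)"
  shows "p dvd qwedge q r" "q = r \<Longrightarrow> p dvd s - t"
proof -
  obtain a b c d where q: "q = (a, b, c, d)" by (cases q)
  obtain a' b' c' d' where r: "r = (a', b', c', d')" by (cases r)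
  have e: "p dvd s*a\<^sup>2 - t*a'\<^sup>2" "p dvd s*a*c - t*a'*c'" "p dvd s*c\<^sup>2 - t*c'\<^sup>2"
  proof -
    show "p dvd s*a\<^sup>2 - t*a'\<^sup>2" using eq unfolding q r by (simp add: mod_eq_dvd_iff)
    have "p dvd (1 + s*a*c) - (1 + t*a'*c')" using eq unfolding q r by (simp only: qunip.simps qmod.simps prod.inject mod_eq_dvd_iff)
    then show "p dvd s*a*c - t*a'*c'" by simp
    have "p dvd (- s*c\<^sup>2) - (- t*c'\<^sup>2)" using eq unfolding q r by (simp only: qunip.simps qmod.simps prod.inject mod_eq_dvd_iff)
    then have "p dvd - ((- s*c\<^sup>2) - (- t*c'\<^sup>2))" by (simp only: dvd_minus_iff)
    then show "p dvd s*c\<^sup>2 - t*c'\<^sup>2" by simp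
  qed
  have "s * (a*c' - c*a')\<^sup>2 = c'\<^sup>2 * (s*a\<^sup>2 - t*a'\<^sup>2) + (- 2*a'*c') * (s*a*c - t*a'*c')
      + a'\<^sup>2 * (s*c\<^sup>2 - t*c'\<^sup>2)"
    by (simp add: algebra_simps power2_eq_square)
  also have "p dvd \<dots>"
    by (rule dvd_add[OF dvd_add[OF dvd_mult[OF e(1)] dvd_mult[OF e(2)]] dvd_mult[OF e(3)]])
  finally have "p dvd (a*c' - c*a')\<^sup>2" using prime_int_dvd_multD[OF prime] s by blast
  then show "p dvd qwedge q r" unfolding q r using prime by (simp add: prime_dvd_power_iff)
  assume "q = r"
  then have [simp]: "a' = a" "c' = c" using q r by auto
  have sa: "p dvd (s - t) * a\<^sup>2" "p dvd (s - t) * c\<^sup>2" using e by (simp_all add: left_diff_distrib)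
  show "p dvd s - t"
  proof (rule ccontr)
    assume n: "\<not> ?thesis"
    then have "p dvd a" "p dvd c"
      using sa prime prime_int_dvd_multD[OF prime _ n] prime_dvd_power by blast+
    then have "p dvd a * d - b * c" by simp
    moreover have "p dvd (a * d - b * c) - 1" using det q by simp
    ultimately have "p dvd 1" using dvd_diff[of p "a*d - b*c" "a*d-b*c-1"] by simp
    then show False using prime not_prime_unit by blast
  qed
qed

text \<open>A conjugate has length \<open>2 * l + m\<close>, so a quotient of two conjugates has
  length \<open>4 * l + 2 * m\<close>. Triples on three distinct points are compared with pairs of
  such quotients.\<close>

lemma card_separated_unipotents:
  assumes R: "R \<subseteq> box l" "separated R" "3 \<le> card R"
    and S: "S \<subseteq> {1..<p}" "\<And>s. s \<in> S \<Longrightarrow> (1, s, 0, 1) \<in> A m"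
  shows "(card R * card S) ^ 3 \<le> 9 * card (box (4 * l + 2 * m)) ^ 2"
proof -
  have fin: "finite R" "finite S"
    using R(1) S(1) finite_box finite_subset by blast+
  have detR: "p dvd qdet q - 1" if "q \<in> R" for q
    using that R(1) box_subset det by blast
  have ndvd: "\<not> p dvd s" if "s \<in> S" for s
    using that S(1) zdvd_imp_le[of p s] by force
  \<comment> \<open>If the triples \<open>(w, y, z)\<close> and \<open>(w', y', z')\<close> have the same image, then left multiplication
    by \<open>k = w' (inverse w)\<close> maps the first to the second, so \<open>k w\<close>, \<open>k y\<close> and \<open>k z\<close> have trace 2.\<close>
  define T where "T = (SIGMA e1:R \<times> S. SIGMA e2:(R - {fst e1}) \<times> S. (R - {fst e1, fst e2}) \<times> S)"
  define n where "n e = qunip (fst e) (snd e)" for e :: "quad \<times> int"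
  define f where "f = (\<lambda>(e1, e2, e3). (qmod p (qmul (qinv (n e1)) (n e2)), qmod p (qmul (qinv (n e1)) (n e3))))"
  have finT: "finite T" unfolding T_def using fin by (intro finite_SigmaI) auto
  have nA: "n e \<in> A (2 * l + m)" if "fst e \<in> R" "snd e \<in> S" for e
    unfolding n_def using that R(1) box_subset S(2) by (intro qunip_mem) auto
  have n_inj: "e = e'" if "fst e \<in> R" "snd e \<in> S" "fst e' \<in> R" "snd e' \<in> S" "qmod p (n e) = qmod p (n e')"
    for e e'
  proof -
    have "fst e = fst e'"
      using qunip_inj(1)[OF detR[OF that(1)] ndvd[OF that(2)]] that R(2)
      unfolding n_def separated_def by blast
    moreover from this have "p dvd snd e - snd e'"
      using qunip_inj(2)[OF detR[OF that(1)] ndvd[OF that(2)]] that unfolding n_def by blast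
    then have "snd e = snd e'" using that S(1) eq_if_dvd_diff[of p "snd e" "snd e'"] by force
    ultimately show ?thesis by (rule prod_eqI)
  qed
  have img: "f ` T \<subseteq> box (4 * l + 2 * m) \<times> box (4 * l + 2 * m)"
  proof -
    have "qmod p (qmul (qinv (n e)) (n e')) \<in> box (4 * l + 2 * m)"
      if "fst e \<in> R" "snd e \<in> S" "fst e' \<in> R" "snd e' \<in> S" for e e'
    proof -
      have "qmul (qinv (n e)) (n e') \<in> A ((2 * l + m) + (2 * l + m))"
        using that by (intro mul inv nA)
      then show ?thesis using qmod_mem_box by (simp add: algebra_simps)
    qed
    then show ?thesis unfolding f_def T_def by auto
  qed
  have "card T \<le> 2 * card (f ` T)"
  proof (rule card_le_twice_image[OF finT])
    fix t0 t1 t2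
    assume t: "t0 \<in> T" "t1 \<in> T" "t2 \<in> T" and eq: "f t0 = f t1" "f t1 = f t2"
    obtain w0 y0 z0 where t0: "t0 = (w0, y0, z0)" by (cases t0)
    obtain w1 y1 z1 where t1: "t1 = (w1, y1, z1)" by (cases t1)
    obtain w2 y2 z2 where t2: "t2 = (w2, y2, z2)" by (cases t2)
    define k where "k w = qmul (n w) (qinv (n w0))" for w
    have detk: "p dvd qdet (k w) - 1" for w
      unfolding k_def n_def by (simp add: qdet_qmul qdet_qinv)
    have kw: "qmod p (qmul (k w) (n w0)) = qmod p (n w)" for w
      unfolding k_def qmul_assoc
      using qmod_qmul_cong[OF refl qmod_qinv(2)[of p "n w0"], of "n w"] by (simp add: n_def)
    have ky: "qmod p (qmul (k w) (n y)) = qmod p (n y')"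
      if "qmod p (qmul (qinv (n w0)) (n y)) = qmod p (qmul (qinv (n w)) (n y'))" for w y y'
    proof -
      have "qmod p (qmul (k w) (n y)) = qmod p (qmul (n w) (qmul (qinv (n w)) (n y')))"
        unfolding k_def qmul_assoc using that qmod_qmul_cong[OF refl] by blast
      then show ?thesis using qmod_qmul_qinv_cancel(1)[of p "n w"] by (simp add: n_def)
    qed
    have e1: "qmod p (qmul (qinv (n w0)) (n y0)) = qmod p (qmul (qinv (n w1)) (n y1))"
      "qmod p (qmul (qinv (n w0)) (n z0)) = qmod p (qmul (qinv (n w1)) (n z1))"
      using eq unfolding t0 t1 f_def prod.case prod.inject by blast+
    have e2: "qmod p (qmul (qinv (n w0)) (n y0)) = qmod p (qmul (qinv (n w2)) (n y2))"
      "qmod p (qmul (qinv (n w0)) (n z0)) = qmod p (qmul (qinv (n w2)) (n z2))"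
      using eq unfolding t0 t1 t2 f_def prod.case prod.inject by (metis, metis)
    have tr: "p dvd qtrace (qmul (k w) (qunip (fst y) (snd y))) - 2"
      if "qmod p (qmul (k w) (n y)) = qmod p (n y')" for w y y'
      using qtrace_cong[OF that] by (simp add: n_def qtrace_qunip)
    have memT: "fst w \<in> R \<and> snd w \<in> S \<and> fst y \<in> R \<and> snd y \<in> S \<and> fst z \<in> R \<and> snd z \<in> S
        \<and> fst w \<noteq> fst y \<and> fst w \<noteq> fst z \<and> fst y \<noteq> fst z" if "(w, y, z) \<in> T" for w y z
      using that unfolding T_def by auto
    note m0 = memT[OF t(1)[unfolded t0]] and m1 = memT[OF t(2)[unfolded t1]] and m2 = memT[OF t(3)[unfolded t2]]
    \<comment> \<open>A trivial translation forces the corresponding triple to be \<open>t0\<close>,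
      and equal translations force \<open>t1 = t2\<close>.\<close>
    have "qmod p (k w1) = qmod p (1, 0, 0, 1) \<or> qmod p (k w2) = qmod p (1, 0, 0, 1) \<or> qmod p (k w1) = qmod p (k w2)"
    proof (rule at_most_one_translation[OF prime odd])
      show "\<not> p dvd qwedge (fst w0) (fst y0)" "\<not> p dvd qwedge (fst w0) (fst z0)" "\<not> p dvd qwedge (fst y0) (fst z0)"
        using m0 R(2) unfolding separated_def by blast+
      show "\<not> p dvd snd w0" "\<not> p dvd snd y0" "\<not> p dvd snd z0" using m0 ndvd by blast+
    qed (rule detk tr[OF kw] tr[OF ky[OF e1(1)]] tr[OF ky[OF e1(2)]] tr[OF ky[OF e2(1)]] tr[OF ky[OF e2(2)]])+
    moreover have eqI: "(w, y, z) = (w', y', z')"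
      if "qmod p h = qmod p h'" "(w, y, z) \<in> T" "(w', y', z') \<in> T"
        "qmod p (qmul h (n w0)) = qmod p (n w)" "qmod p (qmul h' (n w0)) = qmod p (n w')"
        "qmod p (qmul h (n y0)) = qmod p (n y)" "qmod p (qmul h' (n y0)) = qmod p (n y')"
        "qmod p (qmul h (n z0)) = qmod p (n z)" "qmod p (qmul h' (n z0)) = qmod p (n z')"
      for h h' w y z w' y' z'
    proof -
      have "qmod p (qmul h v) = qmod p (qmul h' v)" for v
        using that(1) qmod_qmul_cong by blast
      then have "qmod p (n w) = qmod p (n w')" "qmod p (n y) = qmod p (n y')" "qmod p (n z) = qmod p (n z')"
        using that by simp_all
      then show ?thesis using n_inj memT[OF that(2)] memT[OF that(3)] by simp
    qed
    have one: "t = t0" if "t = (w, y, z)" "t \<in> T" "qmod p (k w) = qmod p (1, 0, 0, 1)"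
       "qmod p (qmul (k w) (n y0)) = qmod p (n y)" "qmod p (qmul (k w) (n z0)) = qmod p (n z)" for t w y z
      using eqI[OF that(3), of w y z w0 y0 z0] that t(1) kw unfolding t0 by simp
    ultimately show "t0 = t1 \<or> t1 = t2 \<or> t0 = t2"
      using one[OF t1 t(2) _ ky[OF e1(1)] ky[OF e1(2)]] one[OF t2 t(3) _ ky[OF e2(1)] ky[OF e2(2)]]
        eqI[OF _ t(2)[unfolded t1] t(3)[unfolded t2] kw kw ky[OF e1(1)] ky[OF e2(1)] ky[OF e1(2)] ky[OF e2(2)]]
      unfolding t1 t2 by blast
  qed
  also have "card (f ` T) \<le> card (box (4 * l + 2 * m)) ^ 2"
    using card_mono[OF _ img] by (simp add: card_cartesian_product power2_eq_square)
  finally have T: "card T \<le> 2 * card (box (4 * l + 2 * m)) ^ 2" by simp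
  let ?r = "card R" and ?s = "card S"
  have "card T = (?r * ?s) * (((?r - 1) * ?s) * ((?r - 2) * ?s))"
  proof -
    have c2: "card ((R - {fst e1, fst e2}) \<times> S) = (?r - 2) * ?s"
      if "e1 \<in> R \<times> S" "e2 \<in> (R - {fst e1}) \<times> S" for e1 e2
      using that fin by (auto simp: card_cartesian_product card_Diff_subset)
    have "card (SIGMA e2:(R - {fst e1}) \<times> S. (R - {fst e1, fst e2}) \<times> S) = ((?r - 1) * ?s) * ((?r - 2) * ?s)"
      if "e1 \<in> R \<times> S" for e1
    proof -
      have "card (SIGMA e2:(R - {fst e1}) \<times> S. (R - {fst e1, fst e2}) \<times> S)
          = (\<Sum>e2\<in>(R - {fst e1}) \<times> S. card ((R - {fst e1, fst e2}) \<times> S))"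
        using fin by (intro card_SigmaI) auto
      also have "\<dots> = (\<Sum>e2\<in>(R - {fst e1}) \<times> S. (?r - 2) * ?s)"
        by (rule sum.cong[OF refl c2[OF that]])
      finally show ?thesis using that fin by (auto simp: card_cartesian_product)
    qed
    then have "card T = (\<Sum>e1\<in>R \<times> S. ((?r - 1) * ?s) * ((?r - 2) * ?s))"
      unfolding T_def using fin by (subst card_SigmaI) (auto intro!: sum.cong finite_SigmaI)
    then show ?thesis by (simp add: card_cartesian_product)
  qed
  then have cT: "card T = ?r * (?r - 1) * (?r - 2) * ?s ^ 3" by (simp add: power3_eq_cube)
  obtain j where j: "?r = j + 3" using R(3) by (metis add.commute le_Suc_ex)
  \<comment> \<open>The ratio r(r - 1)(r - 2) / r^3 is least at r = 3, where it is 2/9.\<close>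
  have "2 * ?r ^ 3 \<le> 9 * (?r * (?r - 1) * (?r - 2))"
    unfolding j by (simp add: algebra_simps power3_eq_cube)
  then have "2 * (?r ^ 3 * ?s ^ 3) \<le> 9 * card T"
    unfolding cT by (metis mult.assoc mult_le_mono1)
  then show ?thesis using T by (simp add: power_mult_distrib)
qed

text \<open>By the choice of \<open>R\<close>, an element and its representative move infinity to
  the same point, so their quotient fixes infinity, that is, its lower left entry is 0.\<close>

lemma card_box_le_borel:
  assumes R: "R \<subseteq> box l" "\<And>q. q \<in> box l \<Longrightarrow> \<exists>r\<in>R. p dvd qwedge r q"
  shows "card (box l) \<le> card R * card {(a, b, c, d) \<in> box (2 * l). c = 0}"
proof -
  define r where "r q = (SOME r. r \<in> R \<and> p dvd qwedge r q)" for q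
  have r: "r q \<in> R \<and> p dvd qwedge (r q) q" if "q \<in> box l" for q
    unfolding r_def by (rule someI_ex) (use R(2)[OF that] in blast)
  have "finite R" using R(1) finite_box finite_subset by blast
  moreover have "finite {(a, b, c, d) \<in> box (2 * l). c = 0}"
    by (rule finite_subset[OF _ finite_box[of "2 * l"]]) auto
  ultimately show ?thesis
  proof (rule card_le_cosets[OF subset_refl, rotated 2])
    fix q assume q: "q \<in> box l"
    show "r q \<in> R \<and> p dvd qdet (r q) - 1"
      using r[OF q] R(1) box_subset det by blast
    have "r q \<in> A l" "q \<in> A l" using r[OF q] q R(1) box_subset by blast+
    then have "qmod p (qmul (qinv (r q)) q) \<in> box (2 * l)"
      using qmod_mem_box[OF mul[OF inv]] by (simp add: mult_2)
    moreover have "fst (snd (snd (qmod p (qmul (qinv r') q')))) = 0" if "p dvd qwedge r' q'" for r' q'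
      using that by (cases r'; cases q') (simp add: algebra_simps dvd_eq_mod_eq_0)
    then have "fst (snd (snd (qmod p (qmul (qinv (r q)) q)))) = 0" using r[OF q] by blast
    ultimately show "qmod p (qmul (qinv (r q)) q) \<in> {(a, b, c, d) \<in> box (2 * l). c = 0}"
      by (cases "qmod p (qmul (qinv (r q)) q)" rule: prod_cases4) simp
  qed
qed

section \<open>Upper unipotents and their multipliers\<close>

definition uppers :: "nat \<Rightarrow> int set" where
  "uppers l = {s \<in> {0..<p}. (1, s, 0, 1) \<in> A l}"

lemma uppers_subset: "uppers l \<subseteq> {0..<p}"
  unfolding uppers_def by auto

lemma finite_uppers [simp]: "finite (uppers l)"
  using uppers_subset finite_subset by blast

text \<open>Upper triangular elements with the same \<open>a\<close> also share \<open>d\<close>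
  modulo \<open>p\<close>, so their quotient is an upper unipotent. The cosets are indexed by
  \<open>a\<close>, and \<open>h\<close> chooses one element for each.\<close>

lemma card_borel_le:
  fixes l
  defines "B \<equiv> {(a, b, c, d) \<in> box (2 * l). c = 0}"
  shows "card B \<le> card (fst ` B) * card (uppers (4 * l))"
proof -
  define h where "h a = (SOME q. q \<in> B \<and> fst q = a)" for a
  have h: "h (fst q) \<in> B \<and> fst (h (fst q)) = fst q" if "q \<in> B" for q
    unfolding h_def by (rule someI[of _ q]) (use that in simp)
  have BA: "B \<subseteq> box (2 * l)" unfolding B_def by auto
  then have finB: "finite B" using finite_box finite_subset by blast
  have "card B \<le> card (h ` fst ` B) * card ((\<lambda>s. (1, s, 0, 1)) ` uppers (4 * l) :: quad set)"
  proof (rule card_le_cosets[OF BA, of "\<lambda>q. h (fst q)"])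
    fix q assume q: "q \<in> B"
    have A: "q \<in> A (2 * l)" "h (fst q) \<in> A (2 * l)" using h[OF q] q BA box_subset by blast+
    then show "h (fst q) \<in> h ` fst ` B \<and> p dvd qdet (h (fst q)) - 1"
      using q det by blast
    obtain a b d where qe: "q = (a, b, 0, d)" using q unfolding B_def by (cases q) auto
    obtain b' d' where he: "h a = (a, b', 0, d')"
      using h[OF q] unfolding B_def qe by (cases "h a") auto
    have "p dvd a * d - 1" "p dvd a * d' - 1"
      using det[OF A(1)] det[OF A(2)] he unfolding qe by simp_all
    then have "(a * d) mod p = 1" "(d' * a) mod p = 1"
      using p_gt_2 by (simp_all add: mod_eq_dvd_iff[symmetric] mult.commute)
    then have e: "qmod p (qmul (qinv (h a)) q) = (1, (d' * b - b' * d) mod p, 0, 1)"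
      unfolding qe he by simp
    have "qmod p (qmul (qinv (h a)) q) \<in> A (2 * l + 2 * l)"
      using qmod_mem[OF mul[OF inv[OF A(2)] A(1)]] unfolding qe by simp
    then have "(d' * b - b' * d) mod p \<in> uppers (4 * l)"
      unfolding e uppers_def using p_gt_2 by simp
    then show "qmod p (qmul (qinv (h (fst q))) q) \<in> (\<lambda>s. (1, s, 0, 1)) ` uppers (4 * l)"
      using e qe by auto
  qed (use finB in auto)
  also have "\<dots> \<le> card (fst ` B) * card (uppers (4 * l))"
    using finB by (intro mult_le_mono card_image_le) auto
  finally show ?thesis .
qed

text \<open>The longest expression that \<open>pivot\<close> produces is
  \<open>a * u - b * u + g * \<eta>\<close> with \<open>\<eta> = s - t + a - b\<close>. Its length
  is \<open>36 * l + 2\<close>, which fits into \<open>44 * l\<close> because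
  \<open>1 \<le> l\<close>.\<close>

lemma card_scaled_uppers:
  assumes l: "1 \<le> l" and G: "G \<subseteq> {0..<p}"
    and scale: "\<And>g s m. g \<in> G \<Longrightarrow> (1, s, 0, 1) \<in> A m \<Longrightarrow> (1, g * s, 0, 1) \<in> A (4 * l + m)"
  shows "min (card (uppers (4 * l)) * card G) (nat p) \<le> 2 * card (uppers (44 * l))"
proof -
  have up: "(1, s, 0, 1) \<in> A (4 * l)" if "s \<in> uppers (4 * l)" for s
    using that unfolding uppers_def by simp
  \<comment> \<open>Scaling \<open>(1, 1, 0, 1)\<close> turns a multiplier itself into an upper
    unipotent, as needed for the terms \<open>g\<close>, \<open>a\<close> and
    \<open>b\<close>.\<close>
  have scale1: "(1, g, 0, 1) \<in> A (4 * l + 1)" if "g \<in> G" for g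
    using scale[OF that upper] by simp
  have mem: "s mod p \<in> uppers (44 * l)" if "(1, s, 0, 1) \<in> A m" "m \<le> 44 * l" for s m
    using upper_cong[of s m "s mod p"] that mono[OF that(2)] p_gt_2 unfolding uppers_def by auto
  have le: "card X \<le> card (uppers (44 * l))" if "X \<subseteq> uppers (44 * l)" for X
    using that by (intro card_mono) auto
  show ?thesis
  proof (rule pivot[OF prime uppers_subset G])
    assume *: "min (card (uppers (4 * l)) * card G) (nat p)
        \<le> 2 * card ((\<lambda>(s, g). (s + g) mod p) ` (uppers (4 * l) \<times> G))"
    have "(\<lambda>(s, g). (s + g) mod p) ` (uppers (4 * l) \<times> G) \<subseteq> uppers (44 * l)"
    proof (intro image_subsetI, clarify)
      fix s g assume "s \<in> uppers (4 * l)" "g \<in> G"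
      then have "(1, s + g, 0, 1) \<in> A (4 * l + (4 * l + 1))" by (intro upper_add up scale1)
      then show "(s + g) mod p \<in> uppers (44 * l)" by (rule mem) (use l in simp)
    qed
    from * le[OF this] show ?thesis by linarith
  next
    fix a b s t \<eta>
    assume ab: "a \<in> G" "b \<in> G" and st: "s \<in> uppers (4 * l)" "t \<in> uppers (4 * l)"
      and \<eta>: "\<eta> = s - t \<or> \<eta> = s - t + a - b"
      and *: "min (card (uppers (4 * l)) * card G) (nat p)
        \<le> 2 * card ((\<lambda>(u, g). ((a - b) * u + g * \<eta>) mod p) ` (uppers (4 * l) \<times> G))"
    have d: "(1, s - t, 0, 1) \<in> A (4 * l + 4 * l)" using st by (intro upper_diff up)
    then have "(1, s - t + a - b, 0, 1) \<in> A ((4 * l + 4 * l) + (4 * l + 1) + (4 * l + 1))"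
      by (rule upper_diff[OF upper_add[OF _ scale1[OF ab(1)]] scale1[OF ab(2)]])
    moreover have "(1, s - t, 0, 1) \<in> A ((4 * l + 4 * l) + (4 * l + 1) + (4 * l + 1))"
      using d mono[of "4 * l + 4 * l" "(4 * l + 4 * l) + (4 * l + 1) + (4 * l + 1)"] by auto
    ultimately have \<eta>A: "(1, \<eta>, 0, 1) \<in> A ((4 * l + 4 * l) + (4 * l + 1) + (4 * l + 1))"
      using \<eta> by blast
    have "(\<lambda>(u, g). ((a - b) * u + g * \<eta>) mod p) ` (uppers (4 * l) \<times> G) \<subseteq> uppers (44 * l)"
    proof (intro image_subsetI, clarify)
      fix u g assume ug: "u \<in> uppers (4 * l)" "g \<in> G"
      have "(1, a * u - b * u + g * \<eta>, 0, 1)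
        \<in> A ((4 * l + 4 * l) + (4 * l + 4 * l) + (4 * l + ((4 * l + 4 * l) + (4 * l + 1) + (4 * l + 1))))"
        by (rule upper_add[OF upper_diff[OF scale[OF ab(1)] scale[OF ab(2)]] scale[OF ug(2) \<eta>A]]) (rule up[OF ug(1)])+
      then have "(a * u - b * u + g * \<eta>) mod p \<in> uppers (44 * l)" by (rule mem) (use l in simp)
      then show "((a - b) * u + g * \<eta>) mod p \<in> uppers (44 * l)" by (simp add: left_diff_distrib)
    qed
    from * le[OF this] show ?thesis by linarith
  qed
qed

text \<open>Exactly half of the residues is impossible for odd \<open>p\<close>, so
  \<open>uppers l\<close> holds more than half and meets its reflection under s -> t - s.\<close>

lemma all_uppers_if_half:
  assumes "nat p \<le> 2 * card (uppers l)"
  shows "(1, t, 0, 1) \<in> A (2 * l)"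
proof -
  let ?V = "(\<lambda>s. (t - s) mod p) ` uppers l"
  have sub: "?V \<subseteq> {0..<p}" using p_gt_2 by auto
  have "inj_on (\<lambda>s. (t - s) mod p) (uppers l)"
  proof (rule inj_onI)
    fix s s' assume s: "s \<in> uppers l" "s' \<in> uppers l" "(t - s) mod p = (t - s') mod p"
    then have "p dvd s' - s" by (simp add: mod_eq_dvd_iff)
    then show "s = s'" using s uppers_subset eq_if_dvd_diff by blast
  qed
  then have "card ?V = card (uppers l)" by (rule card_image)
  moreover have "odd (nat p)" using prime_odd_int[OF prime p_gt_2] p_gt_2 by (simp add: even_nat_iff)
  then have "nat p \<noteq> 2 * card (uppers l)" by fastforce
  moreover have "card (uppers l \<union> ?V) \<le> card {0..<p}"
    using sub uppers_subset by (intro card_mono) auto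
  ultimately have "card (uppers l \<union> ?V) < card (uppers l) + card ?V"
    using assms by simp
  then have "uppers l \<inter> ?V \<noteq> {}"
    using card_Un_disjoint[of "uppers l" ?V] by force
  then obtain s s' where s: "s \<in> uppers l" "s' \<in> uppers l" and e: "s = (t - s') mod p" by blast
  have "(1, s + s', 0, 1) \<in> A (l + l)" using s by (intro upper_add) (simp_all add: uppers_def)
  moreover have "(s + s') mod p = t mod p" unfolding e by (simp add: mod_simps)
  ultimately show ?thesis using upper_cong by (metis mult_2)
qed

text \<open>The constant 4608 is 9 * 8^3. The 8 collects three factors 2: from squaring diagonal
  entries, from the pivot, and from discarding the trivial unipotent. The length 92 is 4 + 2 * 44,
  and 88 is 2 * 44.\<close>

lemma growth_step:
  assumes l: "1 \<le> l"
  shows "(\<forall>s. (1, s, 0, 1) \<in> A (88 * l)) \<or> card (box l) ^ 3 \<le> 4608 * card (box (92 * l)) ^ 2"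
proof (cases "nat p \<le> 2 * card (uppers (44 * l))")
  case True
  then show ?thesis using all_uppers_if_half[OF True] by simp
next
  case False
  obtain R where R: "R \<subseteq> box l" "separated R" "3 \<le> card R"
    and max: "\<And>q. q \<in> box l \<Longrightarrow> \<exists>r\<in>R. p dvd qwedge r q"
    using exists_maximal_separated[OF l] by blast
  define B where "B = {(a, b, c, d) \<in> box (2 * l). c = 0}"
  \<comment> \<open>A diagonal entry \<open>a\<close> acts on the upper unipotents as multiplication
    by \<open>a\<^sup>2\<close>.\<close>
  define G where "G = (\<lambda>a. a\<^sup>2 mod p) ` fst ` B"
  have fstB: "fst ` B \<subseteq> {0..<p}" unfolding B_def box_def by auto
  have G: "G \<subseteq> {0..<p}" unfolding G_def using p_gt_2 by auto
  have scale: "(1, g * s, 0, 1) \<in> A (4 * l + m)" if g: "g \<in> G" and s: "(1, s, 0, 1) \<in> A m" for g s m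
  proof -
    obtain q where qB: "q \<in> B" and gq: "g = (fst q)\<^sup>2 mod p"
      using g unfolding G_def by auto
    then obtain a b d where qe: "q = (a, b, 0, d)" and qbox: "q \<in> box (2 * l)"
      unfolding B_def by (cases q) auto
    have q: "(a, b, 0, d) \<in> A (2 * l)" and ga: "g = a\<^sup>2 mod p"
      using qbox gq box_subset[of "2 * l"] unfolding qe by auto
    have "(1, a\<^sup>2 * s, 0, 1) \<in> A (4 * l + m)" using upper_scale[OF q s] by simp
    then show ?thesis by (rule upper_cong) (simp add: ga mod_simps)
  qed
  let ?u = "card (uppers (44 * l))" and ?s = "card (uppers (4 * l))"
  have "min (?s * card G) (nat p) \<le> 2 * ?u"
    by (rule card_scaled_uppers[OF l G scale])
  then have u: "?s * card G \<le> 2 * ?u" using False by linarith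
  have "card (box l) \<le> card R * (card (fst ` B) * ?s)"
    using card_box_le_borel[OF R(1) max] card_borel_le[of l] unfolding B_def[symmetric]
    by (meson le_trans mult_le_mono2)
  also have "\<dots> \<le> card R * (2 * card G * ?s)"
    using card_square_image[OF fstB] unfolding G_def by (intro mult_le_mono) auto
  also have "\<dots> \<le> card R * (4 * ?u)" using u by (intro mult_le_mono2) (simp add: mult_ac)
  finally have box: "card (box l) \<le> card R * (4 * ?u)" .
  let ?S = "uppers (44 * l) - {0}"
  have "A 1 \<subseteq> A (44 * l)" using l by (intro mono) simp
  then have mem: "{0, 1} \<subseteq> uppers (44 * l)"
    unfolding uppers_def using upper one[of "44 * l"] p_gt_2 by auto
  then have u1: "?u = Suc (card ?S)"
    by (intro card.remove[OF finite_uppers]) simp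
  \<comment> \<open>Since 1 survives, removing 0 at most halves the set.\<close>
  have "1 \<in> ?S" using mem by simp
  then have "card ?S \<noteq> 0" by (metis card_eq_0_iff empty_iff finite_Diff finite_uppers)
  then have "?u \<le> 2 * card ?S" using u1 by linarith
  then have "card (box l) \<le> card R * (4 * (2 * card ?S))"
    using box by (meson le_trans mult_le_mono2)
  then have "card (box l) ^ 3 \<le> (8 * (card R * card ?S)) ^ 3"
    by (intro power_mono) simp_all
  also have "\<dots> = 512 * (card R * card ?S) ^ 3" by (simp add: power_mult_distrib)
  also have "(card R * card ?S) ^ 3 \<le> 9 * card (box (4 * l + 2 * (44 * l))) ^ 2"
    by (rule card_separated_unipotents[OF R]) (auto simp: uppers_def)
  finally show ?thesis by simp
qed

text \<open>For the sizes a and b, \<open>growth_step\<close> gives ln b >= (3/2) ln a - (1/2) ln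
  4608. The lower bound on a makes ln 4608 at most (1/2) ln a, which leaves 5/4.\<close>

lemma ln_growth_step:
  assumes l: "1 \<le> l" and large: "4608\<^sup>2 \<le> card (box l)" and notall: "\<not> (\<forall>s. (1, s, 0, 1) \<in> A (92 * l))"
  shows "5 / 4 * ln (real (card (box l))) \<le> ln (real (card (box (92 * l))))"
proof -
  let ?a = "real (card (box l))" and ?b = "real (card (box (92 * l)))"
  have "\<not> (\<forall>s. (1, s, 0, 1) \<in> A (88 * l))"
    using notall mono[of "88 * l" "92 * l"] by auto
  then have "card (box l) ^ 3 \<le> 4608 * card (box (92 * l)) ^ 2"
    using growth_step[OF l] by blast
  then have "real (card (box l) ^ 3) \<le> real (4608 * card (box (92 * l)) ^ 2)"
    by (rule of_nat_mono)
  then have ab: "?a ^ 3 \<le> 4608 * ?b ^ 2" by simp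
  have a0: "0 < ?a" using large by simp
  then have "?b \<noteq> 0" using ab by (metis mult_zero_right not_le power2_eq_square zero_less_power)
  then have b0: "0 < ?b" by linarith
  have la: "2 * ln 4608 \<le> ln ?a"
  proof -
    have "real (4608\<^sup>2) \<le> ?a" using large by (rule of_nat_mono)
    then have "ln ((4608::real)\<^sup>2) \<le> ln ?a" using a0 by (subst ln_le_cancel_iff) auto
    moreover have "ln ((4608::real)\<^sup>2) = 2 * ln 4608" by (subst ln_realpow) simp_all
    ultimately show ?thesis by linarith
  qed
  have "ln (?a ^ 3) \<le> ln (4608 * ?b ^ 2)" using ab a0 b0 by (subst ln_le_cancel_iff) auto
  moreover have "ln (?a ^ 3) = 3 * ln ?a" by (subst ln_realpow) simp
  moreover have "ln (4608 * ?b ^ 2) = ln 4608 + 2 * ln ?b"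
    using ln_mult_pos[of 4608 "?b ^ 2"] ln_realpow[of ?b 2] zero_less_power[OF b0, of 2] by simp
  ultimately show ?thesis using la by linarith
qed

lemma card_box_large:
  assumes "int N \<le> p"
  shows "N \<le> card (box N)"
proof -
  have "(\<lambda>i. (1, int i, 0, 1)) ` {..<N} \<subseteq> box N"
  proof (intro image_subsetI)
    fix i assume "i \<in> {..<N}"
    then show "(1, int i, 0, 1) \<in> box N"
      using upper_nat[of i] mono[of i N] assms p_gt_2 unfolding box_def by auto
  qed
  then have "card ((\<lambda>i. (1, int i, 0, 1)) ` {..<N} :: quad set) \<le> card (box N)"
    by (rule card_mono[OF finite_box])
  moreover have "inj_on (\<lambda>i. (1, int i, 0, 1) :: quad) {..<N}" by (rule inj_onI) simp
  ultimately show ?thesis by (simp add: card_image)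
qed

text \<open>The start is length 4608^2 because the first 4608^2 powers of
  \<open>(1, 1, 0, 1)\<close> are distinct for such \<open>p\<close>, which is the size that
  \<open>ln_growth_step\<close> asks for. The first alternative is stated one step ahead, at the
  length where the next step looks for unipotents.\<close>

lemma iterated_growth:
  assumes N: "int (4608\<^sup>2) \<le> p"
  shows "(\<forall>s. (1, s, 0, 1) \<in> A (92 ^ Suc i * 4608\<^sup>2)) \<or>
    (5 / 4) ^ i * ln (4608\<^sup>2) \<le> ln (real (card (box (92 ^ i * 4608\<^sup>2))))"
proof (induction i)
  case 0
  have "real (4608\<^sup>2) \<le> real (card (box (4608\<^sup>2)))"
    using card_box_large[OF N] by (rule of_nat_mono)
  then have "ln (real (4608\<^sup>2)) \<le> ln (real (card (box (4608\<^sup>2))))"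
    by (subst ln_le_cancel_iff) auto
  then show ?case by simp
next
  case (Suc i)
  let ?l = "92 ^ i * 4608\<^sup>2 :: nat"
  have l1: "1 \<le> ?l" by simp
  have l92: "92 ^ Suc i * 4608\<^sup>2 = 92 * ?l" by simp
  show ?case
  proof (cases "\<forall>s. (1, s, 0, 1) \<in> A (92 * ?l)")
    case True
    have "A (92 * ?l) \<subseteq> A (92 ^ Suc (Suc i) * 4608\<^sup>2)"
      by (rule mono) simp
    then show ?thesis using True by blast
  next
    case False
    then have IH: "(5 / 4) ^ i * ln (4608\<^sup>2) \<le> ln (real (card (box ?l)))"
      using Suc unfolding l92 by blast
    have "box (4608\<^sup>2) \<subseteq> box ?l" unfolding box_def using mono[of "4608\<^sup>2" ?l] by auto
    then have "card (box (4608\<^sup>2)) \<le> card (box ?l)" by (rule card_mono[OF finite_box])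
    then have "5 / 4 * ln (real (card (box ?l))) \<le> ln (real (card (box (92 * ?l))))"
      using ln_growth_step[OF l1 _ False] card_box_large[OF N] by linarith
    then show ?thesis using IH unfolding l92 by simp
  qed
qed

text \<open>A box has at most p^4 elements, so growth stops at the least \<open>i\<close> with
  (5/4)^i above 4 ln p. Its predecessor \<open>k\<close> satisfies (5/4)^k <= 4 ln p, and 21 is the
  least exponent with 92 <= (5/4)^21, whence 92^k <= (4 ln p)^21. Going from \<open>k\<close> to
  \<open>Suc i\<close> costs 92^2. For \<open>p\<close> below 4608^2 powers of
  \<open>(1, 1, 0, 1)\<close> suffice.\<close>

lemma upper_diameter:
  "\<exists>l. real l \<le> 92\<^sup>2 * 4 ^ 21 * 4608\<^sup>2 * ln (real_of_int p) ^ 21 \<and> (\<forall>s. (1, s, 0, 1) \<in> A l)"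
proof -
  have ln1: "1 \<le> ln (real_of_int p)"
  proof -
    have "exp 1 \<le> real_of_int p" using exp_le p_gt_2 by linarith
    then show ?thesis using p_gt_2 by (subst ln_ge_iff) auto
  qed
  show ?thesis
  proof (cases "int (4608\<^sup>2) \<le> p")
    case False
    have "(1, s, 0, 1) \<in> A (4608\<^sup>2)" for s
    proof -
      have "nat (s mod p) \<le> 4608\<^sup>2" using False pos_mod_bound[of p s] p_gt_2 by linarith
      then have "(1, int (nat (s mod p)), 0, 1) \<in> A (4608\<^sup>2)" using upper_nat mono by blast
      then show ?thesis using p_gt_2 by (elim upper_cong) simp
    qed
    moreover have "real (4608\<^sup>2) \<le> 92\<^sup>2 * 4 ^ 21 * 4608\<^sup>2 * ln (real_of_int p) ^ 21"
    proof -
      have "1 \<le> ln (real_of_int p) ^ 21" using ln1 by (rule one_le_power)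
      then show ?thesis by simp
    qed
    ultimately show ?thesis by blast
  next
    case True
    define L where "L = 4 * ln (real_of_int p)"
    obtain j where j: "L < (5 / 4) ^ j" using real_arch_pow[of "5/4" L] by auto
    define i where "i = (LEAST i. L < (5 / 4) ^ i)"
    have i: "L < (5 / 4) ^ i" unfolding i_def using j by (rule LeastI)
    then have "i \<noteq> 0" using ln1 unfolding L_def by (intro notI) simp
    then obtain k where k: "i = Suc k" using not0_implies_Suc by blast
    then have kL: "(5 / 4) ^ k \<le> L" using not_less_Least[of k "\<lambda>i. L < (5 / 4) ^ i"] unfolding i_def by simp
    have "ln (real (card (box (92 ^ i * 4608\<^sup>2)))) \<le> L"
    proof (cases "card (box (92 ^ i * 4608\<^sup>2)) = 0")
      case True
      then show ?thesis using ln1 unfolding L_def by simp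
    next
      case False
      have "real (card (box (92 ^ i * 4608\<^sup>2))) \<le> real (nat p ^ 4)"
        using card_box_le by (rule of_nat_mono)
      also have "\<dots> = real_of_int p ^ 4" using p_gt_2 by simp
      finally have "ln (real (card (box (92 ^ i * 4608\<^sup>2)))) \<le> ln (real_of_int p ^ 4)"
        using False p_gt_2 by (subst ln_le_cancel_iff) auto
      then show ?thesis using p_gt_2 unfolding L_def by (simp add: ln_realpow)
    qed
    moreover have "L < (5 / 4) ^ i * ln (4608\<^sup>2)"
    proof -
      have "1 \<le> ln ((4608::real)\<^sup>2)"
        using exp_le by (subst ln_ge_iff) simp_all
      then have "(5 / 4) ^ i * 1 \<le> (5 / 4) ^ i * ln ((4608::real)\<^sup>2)" by (intro mult_left_mono) simp_all
      then show ?thesis using i by linarith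
    qed
    ultimately have "\<not> (5 / 4) ^ i * ln (4608\<^sup>2) \<le> ln (real (card (box (92 ^ i * 4608\<^sup>2))))"
      by linarith
    then have "\<forall>s. (1, s, 0, 1) \<in> A (92 ^ Suc i * 4608\<^sup>2)"
      using iterated_growth[OF True, of i] by blast
    moreover have "real (92 ^ Suc i * 4608\<^sup>2) \<le> 92\<^sup>2 * 4 ^ 21 * 4608\<^sup>2 * ln (real_of_int p) ^ 21"
    proof -
      have "(92::real) ^ k \<le> ((5 / 4) ^ 21) ^ k" by (intro power_mono) (simp_all add: power_divide)
      also have "\<dots> = ((5 / 4) ^ k) ^ 21" by (simp only: power_mult[symmetric] mult.commute)
      also have "\<dots> \<le> L ^ 21" using kL by (intro power_mono) simp_all
      also have "\<dots> = 4 ^ 21 * ln (real_of_int p) ^ 21" unfolding L_def by (rule power_mult_distrib)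
      finally have "(92::real) ^ k \<le> 4 ^ 21 * ln (real_of_int p) ^ 21" .
      then show ?thesis unfolding k by (simp add: power2_eq_square)
    qed
    ultimately show ?thesis by blast
  qed
qed

end

section \<open>Matrices modulo a prime\<close>

lemma reduced_matD: "reduced_mat p n A \<Longrightarrow> A \<in> carrier_mat n n"
  unfolding reduced_mat_def by simp

lemma modp_mat_carrier [simp]: "modp_mat p A \<in> carrier_mat n m \<longleftrightarrow> A \<in> carrier_mat n m"
  unfolding modp_mat_def by auto

lemma reduced_modp_mat: "0 < p \<Longrightarrow> A \<in> carrier_mat n n \<Longrightarrow> reduced_mat p n (modp_mat p A)"
  unfolding reduced_mat_def modp_mat_def by auto

lemma modp_mat_eq_iff:
  assumes "A \<in> carrier_mat n m" "B \<in> carrier_mat n m"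
  shows "modp_mat p A = modp_mat p B \<longleftrightarrow> (\<forall>i<n. \<forall>j<m. A $$ (i, j) mod int p = B $$ (i, j) mod int p)"
  using assms unfolding modp_mat_def by (auto simp: mat_eq_iff)

lemma modp_mat_reduced: "reduced_mat p n A \<Longrightarrow> modp_mat p A = A"
  unfolding reduced_mat_def modp_mat_def by (intro eq_matI) auto

lemma modp_mat_idem [simp]: "modp_mat p (modp_mat p A) = modp_mat p A"
  unfolding modp_mat_def by (intro eq_matI) auto

lemma modp_mat_mult_cong:
  assumes "A \<in> carrier_mat n n" "A' \<in> carrier_mat n n" "B \<in> carrier_mat n m" "B' \<in> carrier_mat n m"
    and "modp_mat p A = modp_mat p A'" "modp_mat p B = modp_mat p B'"
  shows "modp_mat p (A * B) = modp_mat p (A' * B')"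
proof -
  have "(\<Sum>k<n. A $$ (i, k) * B $$ (k, j)) mod int p = (\<Sum>k<n. A' $$ (i, k) * B' $$ (k, j)) mod int p"
    if "i < n" "j < m" for i j
  proof -
    have "(\<Sum>k<n. A $$ (i, k) * B $$ (k, j)) mod int p = (\<Sum>k<n. (A $$ (i, k) * B $$ (k, j)) mod int p) mod int p"
      by (rule mod_sum_eq[symmetric])
    also have "(\<Sum>k<n. (A $$ (i, k) * B $$ (k, j)) mod int p) = (\<Sum>k<n. (A' $$ (i, k) * B' $$ (k, j)) mod int p)"
    proof (rule sum.cong[OF refl])
      fix k assume "k \<in> {..<n}"
      then have "A $$ (i, k) mod int p = A' $$ (i, k) mod int p" "B $$ (k, j) mod int p = B' $$ (k, j) mod int p"
        using assms that by (auto simp: modp_mat_eq_iff)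
      then show "(A $$ (i, k) * B $$ (k, j)) mod int p = (A' $$ (i, k) * B' $$ (k, j)) mod int p"
        by (rule mod_mult_cong)
    qed
    finally show ?thesis by (simp add: mod_sum_eq)
  qed
  then show ?thesis
    using assms(1-4) by (subst modp_mat_eq_iff[of _ n m])
      (auto simp: scalar_prod_def atLeast0LessThan)
qed

lemma modp_mat_add_cong:
  assumes "A \<in> carrier_mat n m" "A' \<in> carrier_mat n m" "B \<in> carrier_mat n m" "B' \<in> carrier_mat n m"
    and "modp_mat p A = modp_mat p A'" "modp_mat p B = modp_mat p B'"
  shows "modp_mat p (A + B) = modp_mat p (A' + B')" "modp_mat p (A - B) = modp_mat p (A' - B')"
  using assms modp_mat_eq_iff[of "A + B" n m "A' + B'" p] modp_mat_eq_iff[of "A - B" n m "A' - B'" p]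
  by (auto simp: modp_mat_eq_iff[of _ n m] minus_carrier_mat intro!: mod_add_cong mod_diff_cong)

lemma mulp_carrier [simp]: "A \<in> carrier_mat n n \<Longrightarrow> B \<in> carrier_mat n n \<Longrightarrow> mulp p A B \<in> carrier_mat n n"
  unfolding mulp_def by simp

lemma modp_mat_mulp [simp]: "modp_mat p (mulp p A B) = mulp p A B"
  unfolding mulp_def by simp

lemma mulp_modp_mat:
  assumes "A \<in> carrier_mat n n" "B \<in> carrier_mat n n"
  shows "mulp p (modp_mat p A) B = mulp p A B" "mulp p A (modp_mat p B) = mulp p A B"
  unfolding mulp_def using assms by (auto intro!: modp_mat_mult_cong)

lemma mulp_assoc:
  assumes "A \<in> carrier_mat n n" "B \<in> carrier_mat n n" "C \<in> carrier_mat n n"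
  shows "mulp p (mulp p A B) C = mulp p A (mulp p B C)"
proof -
  have "mulp p (mulp p A B) C = mulp p (A * B) C"
    unfolding mulp_def[of p A B] using assms by (intro mulp_modp_mat) auto
  also have "\<dots> = mulp p A (B * C)"
    unfolding mulp_def using assms by (simp add: assoc_mult_mat)
  also have "\<dots> = mulp p A (mulp p B C)"
    unfolding mulp_def[of p B C] using assms by (intro mulp_modp_mat[symmetric]) auto
  finally show ?thesis .
qed

lemma mulp_one: "reduced_mat p n A \<Longrightarrow> mulp p (1\<^sub>m n) A = A \<and> mulp p A (1\<^sub>m n) = A"
  using modp_mat_reduced[of p n A] reduced_matD[of p n A] unfolding mulp_def by simp

lemma reduced_mulp: "0 < p \<Longrightarrow> A \<in> carrier_mat n n \<Longrightarrow> B \<in> carrier_mat n n \<Longrightarrow> reduced_mat p n (mulp p A B)"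
  unfolding mulp_def by (intro reduced_modp_mat) auto

lemma det_modp_mat:
  assumes "A \<in> carrier_mat n n"
  shows "det (modp_mat p A) mod int p = det A mod int p"
proof -
  have M: "modp_mat p A \<in> carrier_mat n n" using assms by simp
  have "(signof \<pi> * (\<Prod>i = 0..<n. modp_mat p A $$ (i, \<pi> i))) mod int p
      = (signof \<pi> * (\<Prod>i = 0..<n. A $$ (i, \<pi> i))) mod int p"
    if "\<pi> permutes {0..<n}" for \<pi>
  proof -
    have "(\<Prod>i = 0..<n. modp_mat p A $$ (i, \<pi> i)) = (\<Prod>i = 0..<n. A $$ (i, \<pi> i) mod int p)"
      using assms permutes_in_image[OF that] unfolding modp_mat_def by (intro prod.cong) auto
    then show ?thesis
      by (intro mod_mult_cong refl) (simp add: mod_prod_eq)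
  qed
  then have "(\<Sum>\<pi> | \<pi> permutes {0..<n}. (signof \<pi> * (\<Prod>i = 0..<n. modp_mat p A $$ (i, \<pi> i))) mod int p)
    = (\<Sum>\<pi> | \<pi> permutes {0..<n}. (signof \<pi> * (\<Prod>i = 0..<n. A $$ (i, \<pi> i))) mod int p)"
    by (intro sum.cong) auto
  from arg_cong[OF this, of "\<lambda>x. x mod int p"]
  have "(\<Sum>\<pi> | \<pi> permutes {0..<n}. signof \<pi> * (\<Prod>i = 0..<n. modp_mat p A $$ (i, \<pi> i))) mod int p
    = (\<Sum>\<pi> | \<pi> permutes {0..<n}. signof \<pi> * (\<Prod>i = 0..<n. A $$ (i, \<pi> i))) mod int p"
    by (simp only: mod_sum_eq)
  then show ?thesis unfolding det_def'[OF assms] det_def'[OF M] .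
qed

lemma SLpD: "A \<in> SLp p n \<Longrightarrow> reduced_mat p n A \<and> A \<in> carrier_mat n n \<and> det A mod int p = 1"
  unfolding SLp_def reduced_mat_def by simp

lemma mulp_SLp:
  assumes "1 < p" "A \<in> SLp p n" "B \<in> SLp p n"
  shows "mulp p A B \<in> SLp p n"
proof -
  have A: "A \<in> carrier_mat n n" "B \<in> carrier_mat n n" using assms SLpD by blast+
  have "det (mulp p A B) mod int p = (det A * det B) mod int p"
    unfolding mulp_def using A by (simp add: det_modp_mat[of _ n] det_mult)
  also have "\<dots> = ((det A mod int p) * (det B mod int p)) mod int p" by (simp add: mod_mult_eq)
  also have "\<dots> = 1" using assms SLpD by simp
  finally show ?thesis unfolding SLp_def using reduced_mulp A assms(1) by auto
qed

lemma one_SLp: "1 < p \<Longrightarrow> 1\<^sub>m n \<in> SLp p n"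
  unfolding SLp_def reduced_mat_def by auto

text \<open>As the determinant is 1 modulo \<open>p\<close>, the adjugate is a two-sided inverse
  modulo \<open>p\<close>, though not a reduced one.\<close>

lemma exists_inverse_matrix:
  assumes "1 < p" "A \<in> SLp p n"
  obtains B where "B \<in> carrier_mat n n" "mulp p A B = 1\<^sub>m n" "mulp p B A = 1\<^sub>m n"
proof -
  have A: "A \<in> carrier_mat n n" "det A mod int p = 1" using assms SLpD by blast+
  have "modp_mat p (det A \<cdot>\<^sub>m 1\<^sub>m n) = 1\<^sub>m n"
    using A(2) unfolding modp_mat_def by (intro eq_matI) auto
  then show thesis
    using that[of "adj_mat A"] adj_mat[OF A(1)] unfolding mulp_def by simp
qed

text \<open>A left inverse of \<open>A\<close> cancels, so a right inverse is unique modulo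
  \<open>p\<close>; this gives meaning to the definite description in \<open>invp\<close>.
  Multiplicativity of the determinant puts \<open>B\<close> into \<open>SLp\<close>, over which that
  description ranges.\<close>

lemma invp_eqI:
  assumes p: "1 < p" and A: "A \<in> SLp p n" and B: "reduced_mat p n B" "mulp p A B = 1\<^sub>m n"
  shows "B \<in> SLp p n" "invp p n A = B"
proof -
  have cA: "A \<in> carrier_mat n n" and cB: "B \<in> carrier_mat n n" using A B SLpD reduced_matD by blast+
  have "det B mod int p = ((det A mod int p) * det B) mod int p" using A SLpD by simp
  also have "\<dots> = det (mulp p A B) mod int p"
    unfolding mulp_def using cA cB by (simp add: det_modp_mat[of _ n] det_mult mod_mult_left_eq)
  also have "\<dots> = 1" using B(2) p by simp
  finally show BS: "B \<in> SLp p n" unfolding SLp_def using B(1) by simp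
  obtain L where L: "L \<in> carrier_mat n n" "mulp p L A = 1\<^sub>m n"
    using exists_inverse_matrix[OF p A] by blast
  have uniq: "C = modp_mat p L" if C: "C \<in> SLp p n" "mulp p A C = 1\<^sub>m n" for C
  proof -
    have cC: "reduced_mat p n C" "C \<in> carrier_mat n n" using C SLpD by blast+
    have "C = mulp p (mulp p L A) C" using L mulp_one[OF cC(1)] by simp
    also have "\<dots> = mulp p L (1\<^sub>m n)" using C(2) mulp_assoc[OF L(1) cA cC(2)] by simp
    also have "\<dots> = modp_mat p L" unfolding mulp_def using L(1) by simp
    finally show ?thesis .
  qed
  show "invp p n A = B"
    unfolding invp_def using BS B(2) uniq by (intro the_equality) auto
qed

lemma invp_SLp:
  assumes p: "1 < p" and A: "A \<in> SLp p n"
  shows "invp p n A \<in> SLp p n" "mulp p A (invp p n A) = 1\<^sub>m n" "mulp p (invp p n A) A = 1\<^sub>m n"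
proof -
  have cA: "A \<in> carrier_mat n n" using A SLpD by blast
  obtain B where B: "B \<in> carrier_mat n n" "mulp p A B = 1\<^sub>m n" "mulp p B A = 1\<^sub>m n"
    using exists_inverse_matrix[OF p A] by blast
  have "reduced_mat p n (modp_mat p B)" "mulp p A (modp_mat p B) = 1\<^sub>m n" "mulp p (modp_mat p B) A = 1\<^sub>m n"
    using reduced_modp_mat[OF _ B(1)] mulp_modp_mat[OF cA B(1)] mulp_modp_mat[OF B(1) cA] B p by auto
  then show "invp p n A \<in> SLp p n" "mulp p A (invp p n A) = 1\<^sub>m n" "mulp p (invp p n A) A = 1\<^sub>m n"
    using invp_eqI[OF p A] by auto
qed

lemma invp_invp:
  assumes "1 < p" "A \<in> SLp p n"
  shows "invp p n (invp p n A) = A"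
  using invp_eqI(2)[OF assms(1) invp_SLp(1)[OF assms], of A] invp_SLp(3)[OF assms] SLpD[OF assms(2)] by simp

lemma invp_mulp:
  assumes p: "1 < p" and A: "A \<in> SLp p n" and B: "B \<in> SLp p n"
  shows "invp p n (mulp p A B) = mulp p (invp p n B) (invp p n A)"
proof (rule invp_eqI(2)[OF p mulp_SLp[OF assms]])
  note iA = invp_SLp[OF p A] and iB = invp_SLp[OF p B]
  have c: "A \<in> carrier_mat n n" "B \<in> carrier_mat n n" "invp p n A \<in> carrier_mat n n" "invp p n B \<in> carrier_mat n n"
    using A B iA iB SLpD by blast+
  show "reduced_mat p n (mulp p (invp p n B) (invp p n A))" using c p by (intro reduced_mulp) auto
  have "mulp p (mulp p A B) (mulp p (invp p n B) (invp p n A))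
      = mulp p A (mulp p (mulp p B (invp p n B)) (invp p n A))"
    using c by (simp add: mulp_assoc[of _ n])
  also have "\<dots> = 1\<^sub>m n" using iA iB mulp_one[of p n "invp p n A"] SLpD[OF iA(1)] by simp
  finally show "mulp p (mulp p A B) (mulp p (invp p n B) (invp p n A)) = 1\<^sub>m n" .
qed

section \<open>Word length in the generating set\<close>

lemma Xpow_SLp:
  assumes "1 < p" "X \<subseteq> SLp p n"
  shows "Xpow p n X k \<subseteq> SLp p n"
  by (induction k) (use assms in \<open>auto intro!: one_SLp mulp_SLp\<close>)

lemma Xpow_one:
  assumes "1 < p" "1\<^sub>m n \<in> X"
  shows "1\<^sub>m n \<in> Xpow p n X k"
proof (induction k)
  case (Suc k)
  have "mulp p (1\<^sub>m n) (1\<^sub>m n) = 1\<^sub>m n"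
    using mulp_one[of p n "1\<^sub>m n"] SLpD[OF one_SLp[OF assms(1)]] by blast
  then show ?case using Suc assms(2) by force
qed simp

lemma Xpow_mulp:
  assumes p: "1 < p" and X: "X \<subseteq> SLp p n" and A: "A \<in> Xpow p n X k" and B: "B \<in> Xpow p n X m"
  shows "mulp p A B \<in> Xpow p n X (k + m)"
  using A
proof (induction k arbitrary: A)
  case 0
  have "reduced_mat p n B" using Xpow_SLp[OF p X] B SLpD by blast
  then show ?case using 0 B mulp_one by simp
next
  case (Suc k)
  then obtain x A' where xA: "x \<in> X" "A' \<in> Xpow p n X k" "A = mulp p x A'" by auto
  have "x \<in> carrier_mat n n" "A' \<in> carrier_mat n n" "B \<in> carrier_mat n n"
    using xA X Xpow_SLp[OF p X] B SLpD by blast+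
  then have "mulp p A B = mulp p x (mulp p A' B)" unfolding xA(3) by (rule mulp_assoc)
  then show ?case using xA(1) Suc.IH[OF xA(2)] by auto
qed

lemma Xpow_base:
  assumes "X \<subseteq> SLp p n" "A \<in> X"
  shows "A \<in> Xpow p n X 1"
  using assms mulp_one[of p n A] SLpD[of A p n] by force

lemma Xpow_mono:
  assumes p: "1 < p" and X: "X \<subseteq> SLp p n" "1\<^sub>m n \<in> X" and le: "k \<le> m"
  shows "Xpow p n X k \<subseteq> Xpow p n X m"
proof
  fix A assume A: "A \<in> Xpow p n X k"
  then have "mulp p A (1\<^sub>m n) \<in> Xpow p n X (k + (m - k))"
    by (rule Xpow_mulp[OF p X(1) _ Xpow_one[OF p X(2)]])
  moreover have "reduced_mat p n A" using A Xpow_SLp[OF p X(1)] SLpD by blast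
  ultimately show "A \<in> Xpow p n X m" using mulp_one le by simp
qed

lemma Xpow_invp:
  assumes p: "1 < p" and X: "X \<subseteq> SLp p n" "symmetric_set p n X"
  shows "A \<in> Xpow p n X k \<Longrightarrow> invp p n A \<in> Xpow p n X k"
proof (induction k arbitrary: A)
  case 0
  have "invp p n (1\<^sub>m n) = 1\<^sub>m n"
    using one_SLp[OF p] SLpD mulp_one by (intro invp_eqI(2)[OF p]) blast+
  then show ?case using 0 by simp
next
  case (Suc k)
  then obtain x A' where xA: "x \<in> X" "A' \<in> Xpow p n X k" "A = mulp p x A'" by auto
  have "x \<in> SLp p n" "A' \<in> SLp p n" using xA X Xpow_SLp[OF p X(1)] by blast+
  then have "invp p n A = mulp p (invp p n A') (invp p n x)" unfolding xA(3) by (rule invp_mulp[OF p])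
  moreover have "invp p n x \<in> Xpow p n X 1"
    using X xA(1) unfolding symmetric_set_def by (intro Xpow_base) auto
  ultimately show ?case using Xpow_mulp[OF p X(1) Suc.IH[OF xA(2)]] by fastforce
qed

section \<open>A conjugate in general position\<close>

definition outer :: "nat \<Rightarrow> int vec \<Rightarrow> int vec \<Rightarrow> int mat" where
  "outer n u w = mat n n (\<lambda>(i, j). u $ i * w $ j)"

lemma outer_carrier [simp]: "outer n u w \<in> carrier_mat n n"
  unfolding outer_def by simp

lemma mult_outer:
  assumes "A \<in> carrier_mat n n" "u \<in> carrier_vec n"
  shows "A * outer n u w = outer n (A *\<^sub>v u) w"
  using assms unfolding outer_def
  by (intro eq_matI) (auto simp: scalar_prod_def sum_distrib_right mult.assoc)

lemma outer_mult:
  assumes "A \<in> carrier_mat n n" "w \<in> carrier_vec n"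
  shows "outer n u w * A = outer n u (transpose_mat A *\<^sub>v w)"
  using assms unfolding outer_def
  by (intro eq_matI) (auto simp: scalar_prod_def sum_distrib_left mult_ac)

lemma outer_mult_vec:
  assumes "u \<in> carrier_vec n" "w \<in> carrier_vec n" "v \<in> carrier_vec n"
  shows "outer n u w *\<^sub>v v = (w \<bullet> v) \<cdot>\<^sub>v u"
  using assms unfolding outer_def
  by (intro eq_vecI) (auto simp: scalar_prod_def sum_distrib_left mult_ac)

text \<open>The rank one matrix in the middle trades two conditions on the conjugating element for a
  single one that is linear in the middle matrix.\<close>

lemma scalar_prod_outer_conj:
  assumes A: "A \<in> carrier_mat n n" and B: "B \<in> carrier_mat n n"
    and d: "d \<in> carrier_vec n" and \<phi>: "\<phi> \<in> carrier_vec n"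
  shows "\<phi> \<bullet> ((A * outer n d \<phi> * B) *\<^sub>v d) = (\<phi> \<bullet> (A *\<^sub>v d)) * (\<phi> \<bullet> (B *\<^sub>v d))"
proof -
  have "(A * outer n d \<phi> * B) *\<^sub>v d = ((transpose_mat B *\<^sub>v \<phi>) \<bullet> d) \<cdot>\<^sub>v (A *\<^sub>v d)"
    using assms by (simp add: mult_outer outer_mult outer_mult_vec)
  also have "(transpose_mat B *\<^sub>v \<phi>) \<bullet> d = \<phi> \<bullet> (B *\<^sub>v d)"
    using transpose_vec_mult_scalar[OF B d \<phi>] by simp
  finally show ?thesis using assms by (simp add: mult.commute)
qed

lemma dvd_scalar_prod_diff:
  assumes M: "M \<in> carrier_mat n n" and N: "N \<in> carrier_mat n n"
    and d: "d \<in> carrier_vec n" and \<phi>: "\<phi> \<in> carrier_vec n"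
    and eq: "modp_mat p M = modp_mat p N"
  shows "int p dvd \<phi> \<bullet> (M *\<^sub>v d) - \<phi> \<bullet> (N *\<^sub>v d)"
proof -
  have "int p dvd (M - N) $$ (i, j)" if "i < n" "j < n" for i j
    using eq that M N by (simp add: modp_mat_eq_iff[OF M N] mod_eq_dvd_iff)
  then have "int p dvd ((M - N) *\<^sub>v d) $ i" if "i < n" for i
    using d N that by (auto simp: scalar_prod_def simp del: index_minus_mat(1) intro!: dvd_sum dvd_mult2)
  then have "int p dvd \<phi> \<bullet> ((M - N) *\<^sub>v d)"
    using N by (auto simp: scalar_prod_def[of \<phi>] simp del: index_mult_mat_vec intro!: dvd_sum dvd_mult)
  also have "\<phi> \<bullet> ((M - N) *\<^sub>v d) = \<phi> \<bullet> (M *\<^sub>v d) - \<phi> \<bullet> (N *\<^sub>v d)"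
    using assms by (simp add: minus_mult_distrib_mat_vec[of _ n n] scalar_prod_minus_distrib[of _ n])
  finally show ?thesis .
qed

lemma addrow_mat_eq_outer:
  assumes "j \<noteq> i" "i < n" "j < n"
  shows "addrow_mat n a j i = 1\<^sub>m n + outer n (a \<cdot>\<^sub>v unit_vec n j) (unit_vec n i)"
  using assms by (intro eq_matI) (auto simp: addrow_mat_def outer_def)

lemma scalar_prod_addrow_mat:
  fixes d \<phi> :: "int vec"
  assumes "j \<noteq> i" "i < n" "j < n" and d: "d \<in> carrier_vec n" and \<phi>: "\<phi> \<in> carrier_vec n"
  shows "\<phi> \<bullet> (addrow_mat n a j i *\<^sub>v d) = \<phi> \<bullet> d + a * (\<phi> $ j * d $ i)"
proof -
  have "addrow_mat n a j i *\<^sub>v d = d + d $ i \<cdot>\<^sub>v (a \<cdot>\<^sub>v unit_vec n j)"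
    using assms
    by (simp add: addrow_mat_eq_outer add_mult_distrib_mat_vec[of _ n n] outer_mult_vec scalar_prod_left_unit)
  then show ?thesis using assms
    by (simp add: scalar_prod_add_distrib[of _ n] scalar_prod_right_unit mult_ac)
qed

section \<open>Shrinking chains and conjugation of matrices\<close>

lemma finite_reduced_mats: "finite {M. reduced_mat p n M}" "card {M. reduced_mat p n M} \<le> p ^ (n * n)"
proof -
  let ?I = "{..<n} \<times> {..<n}"
  let ?f = "\<lambda>M::int mat. restrict (\<lambda>ij. M $$ ij) ?I"
  let ?P = "PiE ?I (\<lambda>_. {0..<int p})"
  have inj: "inj_on ?f {M. reduced_mat p n M}"
  proof (rule inj_onI)
    fix M N assume "M \<in> {M. reduced_mat p n M}" "N \<in> {M. reduced_mat p n M}" and eq: "?f M = ?f N"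
    then have c: "M \<in> carrier_mat n n" "N \<in> carrier_mat n n" using reduced_matD by auto
    have "M $$ (i, j) = N $$ (i, j)" if "i < n" "j < n" for i j
      using fun_cong[OF eq, of "(i, j)"] that by simp
    then show "M = N" using c by (intro eq_matI) auto
  qed
  have img: "?f ` {M. reduced_mat p n M} \<subseteq> ?P"
    by (intro image_subsetI) (auto simp: reduced_mat_def restrict_PiE_iff)
  have fin: "finite ?P" by (intro finite_PiE) auto
  show "finite {M. reduced_mat p n M}" using inj_on_finite[OF inj img fin] .
  have "card {M. reduced_mat p n M} \<le> card ?P" using inj img fin by (rule card_inj_on_le)
  also have "\<dots> = p ^ (n * n)" by (simp add: card_PiE card_cartesian_product)
  finally show "card {M. reduced_mat p n M} \<le> p ^ (n * n)" .
qed

text \<open>A nonempty set left after \<open>K\<close> halvings would require at least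
  \<open>2 ^ K\<close> elements at the start.\<close>

lemma halving_chain_stabilizes:
  fixes Y :: "nat \<Rightarrow> 'a set"
  assumes fin: "finite (Y 0)" and ne: "\<And>k. Y k \<noteq> {}" and sub: "\<And>k. Y (Suc k) \<subseteq> Y k"
    and half: "\<And>k. Y (Suc k) \<noteq> Y k \<Longrightarrow> 2 * card (Y (Suc k)) \<le> card (Y k)"
    and K: "card (Y 0) < 2 ^ K"
  shows "\<exists>k<K. Y (Suc k) = Y k"
proof (rule ccontr)
  assume no: "\<not> ?thesis"
  have "2 ^ k * card (Y k) \<le> card (Y 0)" if "k \<le> K" for k
    using that
  proof (induction k)
    case (Suc k)
    have "2 ^ Suc k * card (Y (Suc k)) = 2 ^ k * (2 * card (Y (Suc k)))" by simp
    also have "\<dots> \<le> 2 ^ k * card (Y k)" using half no Suc.prems by (intro mult_le_mono2) auto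
    finally show ?case using Suc by linarith
  qed simp
  from this[of K] have "2 ^ K * card (Y K) \<le> card (Y 0)" by simp
  moreover have "finite (Y K)" using fin sub by (induction K) (auto intro: finite_subset)
  then have "1 \<le> card (Y K)" using ne[of K] by (simp add: Suc_le_eq card_gt_0_iff)
  then have "2 ^ K \<le> 2 ^ K * card (Y K)" by simp
  ultimately show False using K by linarith
qed

text \<open>With the inverse on the left this is a right action: conjugating by a product x g means
  conjugating by x first. That matches \<open>Xpow\<close>, whose successor step adds its factor on
  the left.\<close>

definition conjp :: "nat \<Rightarrow> nat \<Rightarrow> int mat \<Rightarrow> int mat \<Rightarrow> int mat" where
  "conjp p n g M = mulp p (mulp p (invp p n g) M) g"

lemma conjp_eq:
  assumes "1 < p" "g \<in> SLp p n" "M \<in> carrier_mat n n"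
  shows "conjp p n g M = modp_mat p (invp p n g * M * g)"
proof -
  have "g \<in> carrier_mat n n" "invp p n g \<in> carrier_mat n n"
    using assms SLpD invp_SLp(1) by blast+
  then have "mulp p (modp_mat p (invp p n g * M)) g = mulp p (invp p n g * M) g"
    using assms(3) by (intro mulp_modp_mat) auto
  then show ?thesis unfolding conjp_def mulp_def by simp
qed

lemma reduced_conjp:
  assumes "1 < p" "g \<in> SLp p n" "M \<in> carrier_mat n n"
  shows "reduced_mat p n (conjp p n g M)"
proof -
  have "g \<in> carrier_mat n n" "invp p n g \<in> carrier_mat n n"
    using assms SLpD invp_SLp(1) by blast+
  then show ?thesis unfolding conjp_eq[OF assms] using assms by (intro reduced_modp_mat) auto
qed

lemma conjp_mulp:
  assumes "1 < p" "g \<in> SLp p n" "h \<in> SLp p n" "M \<in> carrier_mat n n"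
  shows "conjp p n (mulp p g h) M = conjp p n h (conjp p n g M)"
proof -
  have "g \<in> carrier_mat n n" "invp p n g \<in> carrier_mat n n" "h \<in> carrier_mat n n" "invp p n h \<in> carrier_mat n n"
    using assms SLpD invp_SLp(1) by blast+
  then show ?thesis
    using assms unfolding conjp_def by (simp add: invp_mulp mulp_assoc[of _ n])
qed

lemma conjp_one:
  assumes "1 < p" "reduced_mat p n M"
  shows "conjp p n (1\<^sub>m n) M = M"
proof -
  have "invp p n (1\<^sub>m n) = 1\<^sub>m n"
    using one_SLp[OF assms(1)] SLpD mulp_one by (intro invp_eqI(2)[OF assms(1)]) blast+
  then show ?thesis unfolding conjp_def using mulp_one[OF assms(2)] by simp
qed

lemma conjp_diff:
  assumes p: "1 < p" and g: "g \<in> SLp p n" and M: "M \<in> carrier_mat n n" "N \<in> carrier_mat n n"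
  shows "conjp p n g (modp_mat p (M - N)) = modp_mat p (conjp p n g M - conjp p n g N)"
proof -
  let ?i = "invp p n g"
  have c: "g \<in> carrier_mat n n" "?i \<in> carrier_mat n n"
    using assms SLpD invp_SLp(1) by blast+
  have MN: "M - N \<in> carrier_mat n n" using M by (simp add: minus_carrier_mat)
  have "conjp p n g (modp_mat p (M - N)) = modp_mat p (?i * modp_mat p (M - N) * g)"
    using conjp_eq[OF p g] MN by simp
  also have "\<dots> = modp_mat p (?i * (M - N) * g)"
    using c MN by (intro modp_mat_mult_cong[of _ n _ _ n]) auto
  also have "?i * (M - N) * g = ?i * M * g - ?i * N * g"
    using c M by (simp add: mult_minus_distrib_mat[of _ n n _ n] minus_mult_distrib_mat[of _ n n _ _ n])
  also have "modp_mat p \<dots> = modp_mat p (modp_mat p (?i * M * g) - modp_mat p (?i * N * g))"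
    using c M by (intro modp_mat_add_cong(2)[of _ n n]) auto
  finally show ?thesis using conjp_eq[OF p g] M by simp
qed

lemma reduced_vec_nonzero:
  assumes "reduced_vec p n v" "v \<noteq> 0\<^sub>v n"
  obtains i where "i < n" "\<not> int p dvd v $ i"
proof -
  obtain i where i: "i < n" "v $ i \<noteq> 0"
    using assms unfolding reduced_vec_def by (metis carrier_vecD eq_vecI index_zero_vec)
  then have "\<not> int p dvd v $ i"
    using assms zdvd_imp_le[of "int p" "v $ i"] unfolding reduced_vec_def by force
  then show thesis using that i by blast
qed

locale sl_generators =
  fixes p n :: nat and X :: "int mat set"
  assumes prime: "prime p" and XSL: "X \<subseteq> SLp p n" and symm: "symmetric_set p n X"
    and gen: "gen_SLp p n X = SLp p n" and oneX: "1\<^sub>m n \<in> X"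
begin

lemma p_gt_1: "1 < p"
  using prime prime_gt_1_nat by blast

text \<open>Elements of \<open>gen_SLp\<close> may involve inverses, so the induction treats an
  element and its inverse together. Inversion then swaps the two halves, and for generators the
  second half is the symmetry of \<open>X\<close>.\<close>

lemma invariant_under_SLp:
  assumes Y: "\<And>M. M \<in> Y \<Longrightarrow> M \<in> carrier_mat n n"
    and inv: "\<And>x M. x \<in> X \<Longrightarrow> M \<in> Y \<Longrightarrow> conjp p n x M \<in> Y"
    and g: "g \<in> SLp p n" and M: "M \<in> Y"
  shows "conjp p n g M \<in> Y"
proof -
  have one: "conjp p n (1\<^sub>m n) M \<in> Y" if "M \<in> Y" for M
    using inv oneX that by blast
  have "g \<in> gen_SLp p n X" using g gen by simp
  then have "\<forall>M\<in>Y. conjp p n g M \<in> Y \<and> conjp p n (invp p n g) M \<in> Y"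
  proof (induction rule: gen_SLp.induct)
    case one
    have "invp p n (1\<^sub>m n) = 1\<^sub>m n"
      using one_SLp[OF p_gt_1] SLpD mulp_one by (intro invp_eqI(2)[OF p_gt_1]) blast+
    then show ?case using \<open>\<And>M. M \<in> Y \<Longrightarrow> conjp p n (1\<^sub>m n) M \<in> Y\<close> by simp
  next
    case (base A)
    then show ?case using inv symm unfolding symmetric_set_def by blast
  next
    case (mult A B)
    then have AB: "A \<in> SLp p n" "B \<in> SLp p n" using gen by auto
    note i = invp_SLp(1)[OF p_gt_1 AB(1)] invp_SLp(1)[OF p_gt_1 AB(2)]
    show ?case
      using mult.IH Y conjp_mulp[OF p_gt_1 AB] conjp_mulp[OF p_gt_1 i(2,1)] invp_mulp[OF p_gt_1 AB] by simp
  next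
    case (inv A)
    then have "invp p n (invp p n A) = A" using gen invp_invp[OF p_gt_1] by blast
    then show ?case using inv by simp
  qed
  then show ?thesis using M by blast
qed

lemma exists_general_position:
  assumes d: "reduced_vec p n d" "d \<noteq> 0\<^sub>v n" and \<phi>: "reduced_vec p n \<phi>" "\<phi> \<noteq> 0\<^sub>v n"
    and ortho: "int p dvd \<phi> \<bullet> d" and K: "p ^ (n * n) < 2 ^ K"
  obtains g where "g \<in> Xpow p n X K" "\<not> int p dvd \<phi> \<bullet> (g *\<^sub>v d)" "\<not> int p dvd \<phi> \<bullet> (invp p n g *\<^sub>v d)"
proof -
  have cd: "d \<in> carrier_vec n" and c\<phi>: "\<phi> \<in> carrier_vec n"
    using d \<phi> unfolding reduced_vec_def by auto
  define Y where "Y k = {M. reduced_mat p n M \<and>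
      (\<forall>g\<in>Xpow p n X k. int p dvd \<phi> \<bullet> (conjp p n g M *\<^sub>v d))}" for k
  define D where "D = modp_mat p (outer n d \<phi>)"
  have DR: "reduced_mat p n D" unfolding D_def using p_gt_1 by (intro reduced_modp_mat) auto
  have gS: "g \<in> SLp p n" if "g \<in> Xpow p n X k" for g k
    using that Xpow_SLp[OF p_gt_1 XSL] by blast
  have YR: "M \<in> Y k \<Longrightarrow> reduced_mat p n M" for M k unfolding Y_def by simp
  have Yc: "M \<in> Y k \<Longrightarrow> M \<in> carrier_mat n n" for M k using YR reduced_matD by blast
  have conjD: "int p dvd \<phi> \<bullet> (conjp p n g D *\<^sub>v d) \<longleftrightarrow> int p dvd (\<phi> \<bullet> (invp p n g *\<^sub>v d)) * (\<phi> \<bullet> (g *\<^sub>v d))"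
    if g: "g \<in> SLp p n" for g
  proof -
    have c: "g \<in> carrier_mat n n" "invp p n g \<in> carrier_mat n n"
      using g SLpD invp_SLp(1)[OF p_gt_1] by blast+
    have "conjp p n g D = modp_mat p (invp p n g * D * g)"
      using conjp_eq[OF p_gt_1 g reduced_matD[OF DR]] .
    also have "\<dots> = modp_mat p (invp p n g * outer n d \<phi> * g)"
      unfolding D_def using c by (intro modp_mat_mult_cong[of _ n _ _ n]) auto
    finally have eq: "modp_mat p (conjp p n g D) = modp_mat p (invp p n g * outer n d \<phi> * g)" by simp
    have "int p dvd \<phi> \<bullet> (conjp p n g D *\<^sub>v d) - \<phi> \<bullet> ((invp p n g * outer n d \<phi> * g) *\<^sub>v d)"
      by (rule dvd_scalar_prod_diff[OF _ _ cd c\<phi> eq])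
        (use c reduced_matD[OF reduced_conjp[OF p_gt_1 g reduced_matD[OF DR]]] in auto)
    then show ?thesis
      unfolding scalar_prod_outer_conj[OF c(2,1) cd c\<phi>]
      using dvd_diff_right_iff dvd_diff_left_iff by blast
  qed
  \<comment> \<open>The first letter of a word is split off. Hence, if
    \<open>Y (Suc k) = Y k\<close>, this set is stable under conjugation by
    \<open>X\<close>.\<close>
  have step: "M \<in> Y (Suc k) \<longleftrightarrow> reduced_mat p n M \<and> (\<forall>x\<in>X. conjp p n x M \<in> Y k)" for M k
  proof -
    have "(\<forall>g\<in>Xpow p n X (Suc k). int p dvd \<phi> \<bullet> (conjp p n g M *\<^sub>v d))
        \<longleftrightarrow> (\<forall>x\<in>X. \<forall>g\<in>Xpow p n X k. int p dvd \<phi> \<bullet> (conjp p n (mulp p x g) M *\<^sub>v d))"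
      by auto
    moreover have "conjp p n (mulp p x g) M = conjp p n g (conjp p n x M)"
      if "x \<in> X" "g \<in> Xpow p n X k" "reduced_mat p n M" for x g
      using that XSL gS reduced_matD by (intro conjp_mulp[OF p_gt_1]) auto
    moreover have "reduced_mat p n (conjp p n x M)" if "x \<in> X" "reduced_mat p n M" for x
      using that XSL reduced_matD by (intro reduced_conjp[OF p_gt_1]) auto
    ultimately show ?thesis unfolding Y_def by auto
  qed
  have sub: "Y (Suc k) \<subseteq> Y k" for k
    using step oneX conjp_one[OF p_gt_1] by force
  have zero: "0\<^sub>m n n \<in> Y k" for k
  proof -
    have "conjp p n g (0\<^sub>m n n) = 0\<^sub>m n n" if "g \<in> SLp p n" for g
    proof -
      have "g \<in> carrier_mat n n" "invp p n g \<in> carrier_mat n n"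
        using that SLpD invp_SLp(1)[OF p_gt_1] by blast+
      moreover have "modp_mat p (0\<^sub>m n n) = 0\<^sub>m n n" unfolding modp_mat_def by (intro eq_matI) auto
      ultimately show ?thesis using conjp_eq[OF p_gt_1 that, of "0\<^sub>m n n"] by simp
    qed
    moreover have "0\<^sub>m n n *\<^sub>v d = 0\<^sub>v n" using cd by (intro eq_vecI) auto
    ultimately show ?thesis unfolding Y_def reduced_mat_def using gS p_gt_1 c\<phi> by auto
  qed
  have diff: "modp_mat p (M - N) \<in> Y k" if M: "M \<in> Y k" and N: "N \<in> Y k" for M N k
  proof -
    have MN: "M - N \<in> carrier_mat n n" using Yc[OF M] Yc[OF N] by (simp add: minus_carrier_mat)
    have "int p dvd \<phi> \<bullet> (conjp p n g (modp_mat p (M - N)) *\<^sub>v d)" if g: "g \<in> Xpow p n X k" for g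
    proof -
      let ?M = "conjp p n g M" and ?N = "conjp p n g N"
      have c: "?M \<in> carrier_mat n n" "?N \<in> carrier_mat n n"
        using reduced_conjp[OF p_gt_1 gS[OF g]] Yc[OF M] Yc[OF N] reduced_matD by blast+
      have "int p dvd \<phi> \<bullet> (conjp p n g (modp_mat p (M - N)) *\<^sub>v d) - \<phi> \<bullet> ((?M - ?N) *\<^sub>v d)"
        using conjp_diff[OF p_gt_1 gS[OF g] Yc[OF M] Yc[OF N]] c
        by (intro dvd_scalar_prod_diff[OF _ _ cd c\<phi>]) (auto simp: minus_carrier_mat)
      moreover have "\<phi> \<bullet> ((?M - ?N) *\<^sub>v d) = \<phi> \<bullet> (?M *\<^sub>v d) - \<phi> \<bullet> (?N *\<^sub>v d)"
        using c cd c\<phi> by (simp add: minus_mult_distrib_mat_vec[of _ n n] scalar_prod_minus_distrib[of _ n])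
      moreover have "int p dvd \<phi> \<bullet> (?M *\<^sub>v d) - \<phi> \<bullet> (?N *\<^sub>v d)"
        using M N g unfolding Y_def by (intro dvd_diff) auto
      ultimately show ?thesis using dvd_diff_left_iff by metis
    qed
    then show ?thesis unfolding Y_def using reduced_modp_mat[OF _ MN] p_gt_1 by auto
  qed
  have sub_sub: "modp_mat p (M - modp_mat p (M - N)) = N" if "M \<in> Y k" "N \<in> Y j" for M N k j
  proof -
    have c: "M \<in> carrier_mat n n" "N \<in> carrier_mat n n" using that Yc by blast+
    have "modp_mat p (M - modp_mat p (M - N)) = modp_mat p (M - (M - N))"
      using c by (intro modp_mat_add_cong(2)[of _ n n]) (auto simp: minus_carrier_mat)
    also have "M - (M - N) = N" using c by (intro eq_matI) auto
    finally show ?thesis using modp_mat_reduced[OF YR[OF that(2)]] by simp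
  qed
  have fin: "finite (Y k)" for k
    using finite_reduced_mats(1)[of p n] by (rule rev_finite_subset) (auto simp: Y_def)
  have half: "2 * card (Y (Suc k)) \<le> card (Y k)" if ne: "Y (Suc k) \<noteq> Y k" for k
  proof -
    obtain N where N: "N \<in> Y k" "N \<notin> Y (Suc k)" using ne sub by blast
    \<comment> \<open>Subtracting \<open>N\<close> moves the subgroup \<open>Y (Suc k)\<close> to
      another coset inside \<open>Y k\<close>, so \<open>Y k\<close> has room for two disjoint
      copies of it.\<close>
    let ?f = "\<lambda>M. modp_mat p (M - N)"
    have img: "?f ` Y (Suc k) \<subseteq> Y k - Y (Suc k)"
    proof (intro image_subsetI DiffI)
      fix M assume M: "M \<in> Y (Suc k)"
      then show "?f M \<in> Y k" using diff N sub by blast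
      show "?f M \<notin> Y (Suc k)"
      proof
        assume "?f M \<in> Y (Suc k)"
        then have "modp_mat p (M - ?f M) \<in> Y (Suc k)" by (rule diff[OF M])
        then show False using sub_sub[OF M N(1)] N(2) by simp
      qed
    qed
    have "inj_on ?f (Y (Suc k))"
    proof (rule inj_on_inverseI[of _ "\<lambda>M. modp_mat p (M + N)"])
      fix M assume M: "M \<in> Y (Suc k)"
      have c: "M \<in> carrier_mat n n" "N \<in> carrier_mat n n" using M N Yc by blast+
      have "modp_mat p (?f M + N) = modp_mat p ((M - N) + N)"
        using c by (intro modp_mat_add_cong(1)[of _ n n]) (auto simp: minus_carrier_mat)
      also have "(M - N) + N = M" using c by (intro eq_matI) auto
      finally show "modp_mat p (?f M + N) = M" using modp_mat_reduced[OF YR[OF M]] by simp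
    qed
    then have "card (Y (Suc k)) \<le> card (Y k - Y (Suc k))"
      using img fin by (intro card_inj_on_le[of ?f]) auto
    also have "\<dots> = card (Y k) - card (Y (Suc k))" using fin sub by (intro card_Diff_subset) auto
    finally show ?thesis using card_mono[OF fin sub, of k] by linarith
  qed
  have "card (Y 0) \<le> card {M. reduced_mat p n M}"
    using finite_reduced_mats(1) by (intro card_mono) (auto simp: Y_def)
  then have "card (Y 0) < 2 ^ K" using finite_reduced_mats(2)[of p n] K by linarith
  then obtain k where k: "k < K" "Y (Suc k) = Y k"
    using halving_chain_stabilizes[of Y K] fin zero sub half by blast
  have "D \<notin> Y k"
  proof
    assume D: "D \<in> Y k"
    have stable: "conjp p n h D \<in> Y k" if "h \<in> SLp p n" for h
      by (rule invariant_under_SLp[OF Yc _ that D]) (use step k(2) in blast)+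
    have all: "int p dvd (\<phi> \<bullet> (invp p n h *\<^sub>v d)) * (\<phi> \<bullet> (h *\<^sub>v d))" if h: "h \<in> SLp p n" for h
    proof -
      have "int p dvd \<phi> \<bullet> (conjp p n (1\<^sub>m n) (conjp p n h D) *\<^sub>v d)"
        using stable[OF h] Xpow_one[OF p_gt_1 oneX] unfolding Y_def by blast
      then show ?thesis using conjp_one[OF p_gt_1 YR[OF stable[OF h]]] conjD[OF h] by simp
    qed
    \<comment> \<open>Otherwise \<open>d\<close> would be nonzero only at one index
      \<open>i\<close>, with \<open>\<phi>\<close> nonzero there as well, and
      \<open>\<phi> \<bullet> d\<close> would not vanish modulo \<open>p\<close>.\<close>
    have "\<exists>i j. i < n \<and> j < n \<and> j \<noteq> i \<and> \<not> int p dvd d $ i \<and> \<not> int p dvd \<phi> $ j"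
    proof (rule ccontr)
      assume no: "\<not> ?thesis"
      obtain i where i: "i < n" "\<not> int p dvd d $ i" using reduced_vec_nonzero[OF d] by blast
      obtain j where j: "j < n" "\<not> int p dvd \<phi> $ j" using reduced_vec_nonzero[OF \<phi>] by blast
      have ij: "j = i" using no i j by blast
      have "int p dvd (\<Sum>k\<in>{..<n} - {i}. \<phi> $ k * d $ k)"
      proof (intro dvd_sum dvd_mult)
        fix k assume "k \<in> {..<n} - {i}"
        then show "int p dvd d $ k" using no j ij by blast
      qed
      moreover have "\<phi> \<bullet> d = \<phi> $ i * d $ i + (\<Sum>k\<in>{..<n} - {i}. \<phi> $ k * d $ k)"
        using cd i(1) by (simp add: scalar_prod_def atLeast0LessThan sum.remove[of _ i])
      ultimately have "int p dvd \<phi> $ i * d $ i" using ortho by (simp add: dvd_add_left_iff)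
      then show False using i j ij prime by (simp add: prime_dvd_mult_iff)
    qed
    then obtain i j where ij: "i < n" "j < n" "j \<noteq> i" "\<not> int p dvd d $ i" "\<not> int p dvd \<phi> $ j" by blast
    \<comment> \<open>The elementary matrix and its inverse change the value
      \<open>\<phi> \<bullet> d\<close>, which is 0 modulo \<open>p\<close>, by plus and minus
      \<open>\<phi> $ j * d $ i\<close>; neither result vanishes, so \<open>?h\<close> contradicts
      \<open>all\<close>.\<close>
    let ?h = "addrow_mat n (1::int) j i" and ?m = "addrow_mat n (- 1 :: int) j i"
    have hR: "reduced_mat p n ?h"
      using p_gt_1 ij(3) unfolding reduced_mat_def addrow_mat_def by auto
    have hS: "?h \<in> SLp p n"
      unfolding SLp_def using hR p_gt_1 det_addrow_mat[OF ij(3), of n "1::int"] by simp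
    have "mulp p ?h (modp_mat p ?m) = mulp p ?h ?m" by (intro mulp_modp_mat(2)[of _ n]) auto
    also have "\<dots> = modp_mat p (1\<^sub>m n)"
      unfolding mulp_def using addrow_mat_inv[OF ij(2,1,3), of "1::int"] by simp
    also have "\<dots> = 1\<^sub>m n" using SLpD[OF one_SLp[OF p_gt_1]] modp_mat_reduced by blast
    finally have inv: "invp p n ?h = modp_mat p ?m"
      using p_gt_1 by (intro invp_eqI(2)[OF p_gt_1 hS] reduced_modp_mat) auto
    have "int p dvd \<phi> \<bullet> (modp_mat p ?m *\<^sub>v d) - \<phi> \<bullet> (?m *\<^sub>v d)"
      by (rule dvd_scalar_prod_diff[OF _ _ cd c\<phi>]) auto
    moreover have "int p dvd \<phi> \<bullet> (modp_mat p ?m *\<^sub>v d) \<or> int p dvd \<phi> \<bullet> (?h *\<^sub>v d)"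
      using all[OF hS] prime unfolding inv by (simp add: prime_dvd_mult_iff)
    ultimately have "int p dvd \<phi> \<bullet> (?m *\<^sub>v d) \<or> int p dvd \<phi> \<bullet> (?h *\<^sub>v d)"
      using dvd_diff_right_iff by blast
    then have "int p dvd \<phi> $ j * d $ i"
      unfolding scalar_prod_addrow_mat[OF ij(3,1,2) cd c\<phi>]
      using ortho by (auto simp: dvd_add_right_iff dvd_diff_right_iff)
    then show False using ij prime by (simp add: prime_dvd_mult_iff)
  qed
  then obtain g where g: "g \<in> Xpow p n X k" "\<not> int p dvd \<phi> \<bullet> (conjp p n g D *\<^sub>v d)"
    unfolding Y_def using DR by blast
  then have "\<not> int p dvd (\<phi> \<bullet> (invp p n g *\<^sub>v d)) * (\<phi> \<bullet> (g *\<^sub>v d))" using conjD[OF gS] by blast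
  then show thesis
    using that[of g] g(1) Xpow_mono[OF p_gt_1 XSL oneX, of k K] k(1) by (auto intro: dvd_mult dvd_mult2)
qed

end

section \<open>The embedded group of degree two\<close>

text \<open>The linear map that acts as \<open>(a, b, c, d)\<close> on the span of \<open>e1, e2\<close> and trivially on the common
  kernel of \<open>f1, f2\<close>, where \<open>f1, f2\<close> is dual to \<open>e1, e2\<close>.\<close>
fun emb_entry :: "int vec \<Rightarrow> int vec \<Rightarrow> int vec \<Rightarrow> int vec \<Rightarrow> quad \<Rightarrow> nat \<times> nat \<Rightarrow> int" where
  "emb_entry e1 e2 f1 f2 (a, b, c, d) (i, j) = (if i = j then 1 else 0)
     + (((a - 1) * e1 $ i + c * e2 $ i) * f1 $ j + (b * e1 $ i + (d - 1) * e2 $ i) * f2 $ j)"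

definition emb :: "nat \<Rightarrow> nat \<Rightarrow> int vec \<Rightarrow> int vec \<Rightarrow> int vec \<Rightarrow> int vec \<Rightarrow> quad \<Rightarrow> int mat" where
  "emb p n e1 e2 f1 f2 q = modp_mat p (mat n n (emb_entry e1 e2 f1 f2 q))"

lemma emb_cong:
  assumes "qmod (int p) q = qmod (int p) r"
  shows "emb p n e1 e2 f1 f2 q = emb p n e1 e2 f1 f2 r"
proof -
  have "emb_entry e1 e2 f1 f2 q (i, j) mod int p = emb_entry e1 e2 f1 f2 r (i, j) mod int p" for i j
    using assms by (cases q; cases r) (auto intro!: mod_add_cong mod_mult_cong mod_diff_cong)
  then show ?thesis unfolding emb_def by (subst modp_mat_eq_iff[of _ n n]) auto
qed

lemma reduced_emb: "0 < p \<Longrightarrow> reduced_mat p n (emb p n e1 e2 f1 f2 q)"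
  unfolding emb_def by (intro reduced_modp_mat) auto

lemma emb_one: "1 < p \<Longrightarrow> emb p n e1 e2 f1 f2 (1, 0, 0, 1) = 1\<^sub>m n"
  unfolding emb_def modp_mat_def by (intro eq_matI) auto

lemma sum_delta_mult:
  fixes x y :: "nat \<Rightarrow> int"
  assumes "i < n" "j < n"
  shows "(\<Sum>k<n. ((if i = k then 1 else 0) + x k) * ((if k = j then 1 else 0) + y k))
    = (if i = j then 1 else 0) + y i + x j + (\<Sum>k<n. x k * y k)"
proof -
  have "(\<Sum>k<n. ((if i = k then 1 else 0) + x k) * ((if k = j then 1 else 0) + y k))
    = (\<Sum>k<n. (if i = k then (if k = j then 1 else 0) else 0) + (if i = k then y k else 0)
        + (if k = j then x k else 0) + x k * y k)"
    by (intro sum.cong) (auto simp: algebra_simps)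
  then show ?thesis using assms by (simp add: sum.distrib)
qed

text \<open>Let E have the columns \<open>e1\<close>, \<open>e2\<close> and F the rows
  \<open>f1\<close>, \<open>f2\<close>. Then \<open>emb\<close> sends q to 1 + E (q - 1) F, and
  duality F E = 1 makes this multiplicative. In the proof the error is a combination of the four
  entries of F E - 1.\<close>

lemma emb_qmul:
  assumes e: "e1 \<in> carrier_vec n" "e2 \<in> carrier_vec n"
    and dual: "int p dvd f1 \<bullet> e1 - 1" "int p dvd f1 \<bullet> e2" "int p dvd f2 \<bullet> e1" "int p dvd f2 \<bullet> e2 - 1"
  shows "mulp p (emb p n e1 e2 f1 f2 q) (emb p n e1 e2 f1 f2 r) = emb p n e1 e2 f1 f2 (qmul q r)"
proof -
  let ?E = "emb_entry e1 e2 f1 f2"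
  obtain a b c d where q: "q = (a, b, c, d)" by (cases q)
  obtain a' b' c' d' where r: "r = (a', b', c', d')" by (cases r)
  have "(\<Sum>k<n. ?E q (i, k) * ?E r (k, j)) mod int p = ?E (qmul q r) (i, j) mod int p"
    if ij: "i < n" "j < n" for i j
  proof -
    define u v where "u = (a - 1) * e1 $ i + c * e2 $ i" and "v = b * e1 $ i + (d - 1) * e2 $ i"
    define u' v' where "u' = (a' - 1) * f1 $ j + b' * f2 $ j" and "v' = c' * f1 $ j + (d' - 1) * f2 $ j"
    have "(\<Sum>k<n. ?E q (i, k) * ?E r (k, j))
      = (\<Sum>k<n. ((if i = k then 1 else 0) + (u * f1 $ k + v * f2 $ k))
          * ((if k = j then 1 else 0) + (e1 $ k * u' + e2 $ k * v')))"
      unfolding q r u_def v_def u'_def v'_def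
      by (intro sum.cong refl arg_cong2[of _ _ _ _ "(*)"]) (auto simp: algebra_simps)
    also have "\<dots> = (if i = j then 1 else 0) + (e1 $ i * u' + e2 $ i * v') + (u * f1 $ j + v * f2 $ j)
        + (\<Sum>k<n. (u * f1 $ k + v * f2 $ k) * (e1 $ k * u' + e2 $ k * v'))"
      by (rule sum_delta_mult[OF ij])
    also have "(\<Sum>k<n. (u * f1 $ k + v * f2 $ k) * (e1 $ k * u' + e2 $ k * v'))
        = u * u' * (f1 \<bullet> e1) + u * v' * (f1 \<bullet> e2) + v * u' * (f2 \<bullet> e1) + v * v' * (f2 \<bullet> e2)"
      using e by (simp add: scalar_prod_def atLeast0LessThan sum_distrib_left sum.distrib[symmetric] algebra_simps)
    finally have sum: "(\<Sum>k<n. ?E q (i, k) * ?E r (k, j)) - ?E (qmul q r) (i, j)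
        = u * u' * (f1 \<bullet> e1 - 1) + u * v' * (f1 \<bullet> e2) + v * u' * (f2 \<bullet> e1) + v * v' * (f2 \<bullet> e2 - 1)"
      unfolding q r u_def v_def u'_def v'_def by (simp add: algebra_simps)
    have "int p dvd \<dots>" by (intro dvd_add dvd_mult dual)
    then show ?thesis unfolding mod_eq_dvd_iff sum .
  qed
  then have "modp_mat p (mat n n (?E q) * mat n n (?E r)) = modp_mat p (mat n n (?E (qmul q r)))"
    by (subst modp_mat_eq_iff[of _ n n]) (auto simp: scalar_prod_def atLeast0LessThan)
  moreover have "mulp p (emb p n e1 e2 f1 f2 q) (emb p n e1 e2 f1 f2 r)
      = modp_mat p (mat n n (?E q) * mat n n (?E r))"
    unfolding mulp_def emb_def by (intro modp_mat_mult_cong[of _ n _ _ n]) auto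
  ultimately show ?thesis unfolding emb_def by simp
qed

lemma exists_inverse_mod_prime:
  fixes p a :: int
  assumes "prime p" "\<not> p dvd a"
  obtains b where "p dvd b * a - 1"
proof -
  have "gcd a p = 1"
    using assms prime_imp_coprime[of p a] by (simp add: coprime_iff_gcd_eq_1 gcd.commute)
  then obtain u v where "u * a + v * p = 1" using bezout_int[of a p] by metis
  then have "u * a - 1 = - v * p" by linarith
  then show thesis using that[of u] by simp
qed

context sl_generators
begin

text \<open>One unit of filtration length stands for \<open>L\<close> letters of \<open>X\<close>,
  enough to spell both unipotents; products and inverses pass through the homomorphism
  \<open>emb\<close>.\<close>

lemma filtration_emb:
  assumes odd: "p \<noteq> 2" and x: "\<not> int p dvd x"
    and e: "e1 \<in> carrier_vec n" "e2 \<in> carrier_vec n"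
    and dual: "int p dvd f1 \<bullet> e1 - 1" "int p dvd f1 \<bullet> e2" "int p dvd f2 \<bullet> e1" "int p dvd f2 \<bullet> e2 - 1"
    and upper: "emb p n e1 e2 f1 f2 (1, 1, 0, 1) \<in> Xpow p n X L"
    and lower: "emb p n e1 e2 f1 f2 (1, 0, x, 1) \<in> Xpow p n X L"
  shows "sl2_filtration (int p) (\<lambda>l. {q. int p dvd qdet q - 1 \<and> emb p n e1 e2 f1 f2 q \<in> Xpow p n X (l * L)}) x"
proof -
  let ?e = "emb p n e1 e2 f1 f2"
  note hom = emb_qmul[OF e dual]
  have mul: "int p dvd qdet (qmul q r) - 1" if "int p dvd qdet q - 1" "int p dvd qdet r - 1" for q r
  proof -
    have "int p dvd qdet q * (qdet r - 1) + (qdet q - 1)"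
      using that by (intro dvd_add[OF dvd_mult])
    then show ?thesis by (simp add: qdet_qmul algebra_simps)
  qed
  have inv: "?e (qinv q) \<in> Xpow p n X k" if "int p dvd qdet q - 1" "?e q \<in> Xpow p n X k" for q k
  proof -
    have "mulp p (?e q) (?e (qinv q)) = ?e (1, 0, 0, 1)"
      unfolding hom using emb_cong[OF qmod_qinv(1)[OF that(1)]] .
    then have "invp p n (?e q) = ?e (qinv q)"
      using that(2) Xpow_SLp[OF p_gt_1 XSL] p_gt_1
      by (intro invp_eqI(2)[OF p_gt_1] reduced_emb) (auto simp: emb_one)
    then show ?thesis using Xpow_invp[OF p_gt_1 XSL symm that(2)] by simp
  qed
  have det_cong: "int p dvd qdet r - 1" if "int p dvd qdet q - 1" "qmod (int p) q = qmod (int p) r" for q r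
  proof -
    have "qdet q mod int p = qdet r mod int p"
      using that(2) by (cases q; cases r) (auto intro!: mod_diff_cong mod_mult_cong)
    then show ?thesis using that(1) by (simp add: mod_eq_dvd_iff[symmetric])
  qed
  show ?thesis
  proof unfold_locales
    show "Factorial_Ring.prime (int p)" using prime by simp
    show "int p \<noteq> 2" using odd by simp
    fix l m q r
    show "(1, 0, 0, 1) \<in> {q. int p dvd qdet q - 1 \<and> ?e q \<in> Xpow p n X (l * L)}"
      using Xpow_one[OF p_gt_1 oneX] by (simp add: emb_one[OF p_gt_1])
    show "qmul q r \<in> {q. int p dvd qdet q - 1 \<and> ?e q \<in> Xpow p n X ((l + m) * L)}"
      if "q \<in> {q. int p dvd qdet q - 1 \<and> ?e q \<in> Xpow p n X (l * L)}"
        "r \<in> {q. int p dvd qdet q - 1 \<and> ?e q \<in> Xpow p n X (m * L)}"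
      using that mul Xpow_mulp[OF p_gt_1 XSL, of "?e q" "l * L" "?e r" "m * L"]
      unfolding hom by (simp add: add_mult_distrib)
    show "qinv q \<in> {q. int p dvd qdet q - 1 \<and> ?e q \<in> Xpow p n X (l * L)}"
      if "q \<in> {q. int p dvd qdet q - 1 \<and> ?e q \<in> Xpow p n X (l * L)}"
      using that inv by (simp add: qdet_qinv)
    show "r \<in> {q. int p dvd qdet q - 1 \<and> ?e q \<in> Xpow p n X (l * L)}"
      if "q \<in> {q. int p dvd qdet q - 1 \<and> ?e q \<in> Xpow p n X (l * L)}" "qmod (int p) q = qmod (int p) r"
      using that(1) det_cong[OF _ that(2)] emb_cong[OF that(2)] by simp
  qed (use upper lower x in auto)
qed

text \<open>The plane is spanned by d and g d, with phi g^-1 and phi as coordinate functions after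
  scaling. The inverses \<open>a\<close> and \<open>b\<close> of the two values in general position
  normalise the diagonal pairings to 1.\<close>

lemma transvection_group_in_power:
  assumes odd: "p \<noteq> 2" and K: "p ^ (n * n) < 2 ^ K" and t: "t \<in> X" "transvection p n t"
  shows "\<exists>l. real l \<le> 92\<^sup>2 * 4 ^ 21 * 4608\<^sup>2 * ln (real p) ^ 21 \<and>
    transvection_group p n t \<subseteq> Xpow p n X (l * (2 * K + 1))"
proof -
  obtain d \<phi> where d: "reduced_vec p n d" "d \<noteq> 0\<^sub>v n" and \<phi>: "reduced_vec p n \<phi>" "\<phi> \<noteq> 0\<^sub>v n"
    and ortho: "int p dvd \<phi> \<bullet> d" and td: "t = modp_mat p (1\<^sub>m n + outer n d \<phi>)"
    using t(2) unfolding transvection_def outer_def by (auto simp: dvd_eq_mod_eq_0)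
  have cd: "d \<in> carrier_vec n" and c\<phi>: "\<phi> \<in> carrier_vec n"
    using d \<phi> unfolding reduced_vec_def by auto
  obtain g where g: "g \<in> Xpow p n X K"
    and \<alpha>: "\<not> int p dvd \<phi> \<bullet> (g *\<^sub>v d)" and \<beta>: "\<not> int p dvd \<phi> \<bullet> (invp p n g *\<^sub>v d)"
    using exists_general_position[OF d \<phi> ortho K] .
  have gS: "g \<in> SLp p n" using g Xpow_SLp[OF p_gt_1 XSL] by blast
  let ?h = "invp p n g"
  have cg: "g \<in> carrier_mat n n" and ch: "?h \<in> carrier_mat n n"
    using gS SLpD invp_SLp(1)[OF p_gt_1] by blast+
  define \<alpha>' \<beta>' where "\<alpha>' = \<phi> \<bullet> (g *\<^sub>v d)" and "\<beta>' = \<phi> \<bullet> (?h *\<^sub>v d)"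
  have pp: "Factorial_Ring.prime (int p)" using prime by simp
  obtain a where a: "int p dvd a * \<alpha>' - 1" using exists_inverse_mod_prime[OF pp \<alpha>] unfolding \<alpha>'_def by blast
  obtain b where b: "int p dvd b * \<beta>' - 1" using exists_inverse_mod_prime[OF pp \<beta>] unfolding \<beta>'_def by blast
  define d' \<phi>' where "d' = g *\<^sub>v d" and "\<phi>' = transpose_mat ?h *\<^sub>v \<phi>"
  have cd': "d' \<in> carrier_vec n" and c\<phi>': "\<phi>' \<in> carrier_vec n"
    unfolding d'_def \<phi>'_def using cg ch cd c\<phi> by auto
  let ?e = "emb p n d (a \<cdot>\<^sub>v d') (b \<cdot>\<^sub>v \<phi>') \<phi>"
  have \<phi>'v: "\<phi>' \<bullet> v = \<phi> \<bullet> (?h *\<^sub>v v)" if "v \<in> carrier_vec n" for v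
    unfolding \<phi>'_def using transpose_vec_mult_scalar[OF ch that c\<phi>] .
  have dual: "int p dvd (b \<cdot>\<^sub>v \<phi>') \<bullet> d - 1" "int p dvd (b \<cdot>\<^sub>v \<phi>') \<bullet> (a \<cdot>\<^sub>v d')"
    "int p dvd \<phi> \<bullet> d" "int p dvd \<phi> \<bullet> (a \<cdot>\<^sub>v d') - 1"
  proof -
    show "int p dvd (b \<cdot>\<^sub>v \<phi>') \<bullet> d - 1"
      using b c\<phi>' cd \<phi>'v[OF cd] unfolding \<beta>'_def by simp
    show "int p dvd \<phi> \<bullet> (a \<cdot>\<^sub>v d') - 1"
      using a c\<phi> cd' unfolding \<alpha>'_def d'_def by simp
    \<comment> \<open>This pairing is phi(g^-1 g d) = phi(d) = 0.\<close>
    have "modp_mat p (?h * g) = modp_mat p (1\<^sub>m n)"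
      using invp_SLp(3)[OF p_gt_1 gS] unfolding mulp_def by (metis modp_mat_idem)
    then have "int p dvd \<phi> \<bullet> ((?h * g) *\<^sub>v d) - \<phi> \<bullet> (1\<^sub>m n *\<^sub>v d)"
      using cg ch by (intro dvd_scalar_prod_diff[OF _ _ cd c\<phi>]) auto
    then have "int p dvd \<phi>' \<bullet> d'"
      using ortho cg ch cd \<phi>'v[OF cd'] dvd_diff_left_iff[of "int p" "\<phi> \<bullet> d"] unfolding d'_def
      by (simp add: dvd_diff_left_iff)
    then show "int p dvd (b \<cdot>\<^sub>v \<phi>') \<bullet> (a \<cdot>\<^sub>v d')" using c\<phi>' cd' by simp
  qed (rule ortho)
  have upper_emb: "?e (1, s, 0, 1) = modp_mat p (1\<^sub>m n + s \<cdot>\<^sub>m outer n d \<phi>)" for s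
    unfolding emb_def by (intro arg_cong[of _ _ "modp_mat p"] eq_matI) (auto simp: outer_def)
  have upper: "?e (1, 1, 0, 1) \<in> Xpow p n X (2 * K + 1)"
  proof -
    have "?e (1, 1, 0, 1) = t" unfolding upper_emb td by (intro arg_cong[of _ _ "modp_mat p"] eq_matI) auto
    then show ?thesis
      using Xpow_base[OF XSL t(1)] Xpow_mono[OF p_gt_1 XSL oneX, of 1 "2 * K + 1"] by auto
  qed
  \<comment> \<open>The conjugate of \<open>t\<close> by \<open>g\<close> has length K + 1 + K.
    Since \<open>a * \<alpha>'\<close> and \<open>b * \<beta>'\<close> are 1 modulo
    \<open>p\<close>, its rank one part is \<open>\<alpha>' * \<beta>'\<close> times that of the
    normalised vectors.\<close>
  have lower: "?e (1, 0, \<alpha>' * \<beta>', 1) \<in> Xpow p n X (2 * K + 1)"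
  proof -
    have "mulp p (mulp p g t) ?h \<in> Xpow p n X ((K + 1) + K)"
      by (rule Xpow_mulp[OF p_gt_1 XSL Xpow_mulp[OF p_gt_1 XSL g Xpow_base[OF XSL t(1)]]
            Xpow_invp[OF p_gt_1 XSL symm g]])
    also have "mulp p (mulp p g t) ?h = modp_mat p (1\<^sub>m n + outer n d' \<phi>')"
    proof -
      let ?D = "outer n d \<phi>"
      have "mulp p g t = mulp p g (1\<^sub>m n + ?D)" unfolding td using cg by (intro mulp_modp_mat) auto
      then have "mulp p (mulp p g t) ?h = mulp p (modp_mat p (g * (1\<^sub>m n + ?D))) ?h" by (simp add: mulp_def)
      also have "\<dots> = mulp p (g * (1\<^sub>m n + ?D)) ?h" using cg ch by (intro mulp_modp_mat) auto
      also have "\<dots> = modp_mat p (g * ?h + outer n d' \<phi>')"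
        unfolding mulp_def d'_def \<phi>'_def using cg ch cd c\<phi>
        by (simp add: mult_add_distrib_mat[of _ n n _ n] add_mult_distrib_mat[of _ n n _ _ n] mult_outer outer_mult
            del: assoc_mult_mat)
      also have "\<dots> = modp_mat p (1\<^sub>m n + outer n d' \<phi>')"
        using cg ch invp_SLp(2)[OF p_gt_1 gS] modp_mat_idem[of p "g * ?h"]
        by (intro modp_mat_add_cong(1)[of _ n n]) (auto simp: mulp_def)
      finally show ?thesis .
    qed
    also have "\<dots> = ?e (1, 0, \<alpha>' * \<beta>', 1)"
    proof -
      have "int p dvd x * y - (\<alpha>' * \<beta>') * (a * x) * (b * y)" for x y
      proof -
        have "x * y - (\<alpha>' * \<beta>') * (a * x) * (b * y)
          = - (x * y) * (b * \<beta>') * (a * \<alpha>' - 1) + - (x * y) * (b * \<beta>' - 1)"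
          by (simp add: algebra_simps)
        also have "int p dvd \<dots>" using a b by (intro dvd_add[OF dvd_mult dvd_mult])
        finally show ?thesis .
      qed
      then show ?thesis
        unfolding emb_def using cd' c\<phi>'
        by (subst modp_mat_eq_iff[of _ n n]) (auto simp: outer_def mod_eq_dvd_iff mult.assoc)
    qed
    finally show ?thesis by (simp add: mult_2 add.commute add.left_commute)
  qed
  have x: "\<not> int p dvd \<alpha>' * \<beta>'"
    using \<alpha> \<beta> pp unfolding \<alpha>'_def \<beta>'_def by (simp add: prime_dvd_mult_iff)
  interpret sl2: sl2_filtration "int p"
    "\<lambda>l. {q. int p dvd qdet q - 1 \<and> ?e q \<in> Xpow p n X (l * (2 * K + 1))}" "\<alpha>' * \<beta>'"
    using cd' by (intro filtration_emb[OF odd x cd _ dual upper lower]) simp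
  obtain l where l: "real l \<le> 92\<^sup>2 * 4 ^ 21 * 4608\<^sup>2 * ln (real p) ^ 21"
    and all: "\<And>s. ?e (1, s, 0, 1) \<in> Xpow p n X (l * (2 * K + 1))"
    using sl2.upper_diameter by auto
  have "modp_mat p (1\<^sub>m n + s \<cdot>\<^sub>m (t - 1\<^sub>m n)) = ?e (1, s, 0, 1)" for s
  proof -
    have "(y + s * (x mod int p - y)) mod int p = (y + s * (x - y)) mod int p" for x y
      by (intro mod_add_cong mod_mult_cong mod_diff_cong refl) simp
    from this[of 1] this[of 0] show ?thesis
      unfolding upper_emb td by (subst modp_mat_eq_iff[of _ n n]) (auto simp: modp_mat_def outer_def)
  qed
  then have "transvection_group p n t \<subseteq> Xpow p n X (l * (2 * K + 1))"
    unfolding transvection_group_def using all by auto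
  then show ?thesis using l by blast
qed

end

text \<open>For \<open>p = 2\<close> the only multipliers are 0 and 1, so the group consists of the
  identity and \<open>t\<close>.\<close>

lemma transvection_group_two:
  assumes "1\<^sub>m n \<in> X" "X \<subseteq> SLp 2 n" "t \<in> X"
  shows "transvection_group 2 n t \<subseteq> Xpow 2 n X 1"
proof
  fix M assume "M \<in> transvection_group 2 n t"
  then obtain s where s: "0 \<le> s" "s < 2" "M = modp_mat 2 (1\<^sub>m n + s \<cdot>\<^sub>m (t - 1\<^sub>m n))"
    unfolding transvection_group_def by auto
  have t: "reduced_mat 2 n t" "t \<in> carrier_mat n n" using assms SLpD by blast+
  have one: "modp_mat 2 (1\<^sub>m n) = 1\<^sub>m n" using SLpD[OF one_SLp[of 2 n]] modp_mat_reduced by auto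
  have "s = 0 \<or> s = 1" using s by linarith
  then have "M = 1\<^sub>m n \<or> M = t"
  proof
    assume "s = 0"
    moreover have "1\<^sub>m n + 0 \<cdot>\<^sub>m (t - 1\<^sub>m n) = 1\<^sub>m n" using t by (intro eq_matI) auto
    ultimately show ?thesis using s one by simp
  next
    assume "s = 1"
    moreover have "1\<^sub>m n + 1 \<cdot>\<^sub>m (t - 1\<^sub>m n) = t" using t by (intro eq_matI) auto
    ultimately show ?thesis using s modp_mat_reduced[OF t(1)] by simp
  qed
  then show "M \<in> Xpow 2 n X 1" using assms Xpow_base by blast
qed

lemma half_le_ln_two: "1 / 2 \<le> ln (2::real)"
  using ln_le_minus_one[of "1 / 2"] by (simp add: ln_div)

text \<open>One factor 2 pays for rounding the logarithm up, as \<open>1 \<le> log 2 p\<close>, and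
  the other for 1 / ln 2 <= 2.\<close>

lemma exists_power_of_two:
  assumes "2 \<le> p"
  obtains k where "p < 2 ^ k" "real k \<le> 4 * ln (real p)"
proof -
  define k where "k = nat \<lfloor>log 2 (real p)\<rfloor> + 1"
  have log1: "1 \<le> log 2 (real p)" using assms by (simp add: le_log_iff)
  have "log 2 (real p) < real k" unfolding k_def using log1 by linarith
  then have "real p < 2 powr real k" using assms by (simp add: log_less_iff)
  then have "real p < real (2 ^ k)" by (simp add: powr_realpow)
  then have "p < 2 ^ k" by (simp only: of_nat_less_iff)
  moreover have "real k \<le> 4 * ln (real p)"
  proof -
    have "real k \<le> 2 * log 2 (real p)" unfolding k_def using log1 by linarith
    also have "\<dots> = 2 * ln (real p) / ln 2" by (simp add: log_def)
    also have "\<dots> \<le> 2 * ln (real p) / (1 / 2)"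
      using half_le_ln_two assms by (intro divide_left_mono) auto
    finally show ?thesis by simp
  qed
  ultimately show thesis using that by blast
qed

theorem theorem3p2:
  shows "\<exists>c::real. c > 0 \<and> (\<exists>C::real. C > 0 \<and>
    (\<forall>(p::nat) (n::nat) (X :: int mat set).
       prime p \<longrightarrow> n \<ge> 3 \<longrightarrow> X \<subseteq> SLp p n \<longrightarrow> symmetric_set p n X \<longrightarrow>
       gen_SLp p n X = SLp p n \<longrightarrow> 1\<^sub>m n \<in> X \<longrightarrow> (\<exists>t\<in>X. transvection p n t) \<longrightarrow>
       (\<exists>l::nat. real l \<le> C * (ln (real p)) powr c * (real n)^2 \<and>
          (\<exists>s. transvection p n s \<and> transvection_group p n s \<subseteq> Xpow p n X l))))"
\<comment> \<open>The length inside SL_2(p) gives 21 logarithms; the unit of length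
  \<open>2 * K + 1\<close> gives the last one and n^2. As K <= 4 ln p n^2 and ln p n^2 >= 9/2, that
  unit is at most (8 + 1) ln p n^2.\<close>
proof (rule exI[of _ 22], intro conjI exI[of _ "9 * (92\<^sup>2 * 4 ^ 21 * 4608\<^sup>2) :: real"] allI impI)
  fix p n :: nat and X :: "int mat set"
  assume prime: "prime p" and n: "3 \<le> n" and X: "X \<subseteq> SLp p n" "symmetric_set p n X"
    "gen_SLp p n X = SLp p n" "1\<^sub>m n \<in> X" and ex: "\<exists>t\<in>X. transvection p n t"
  let ?C = "92\<^sup>2 * 4 ^ 21 * 4608\<^sup>2 :: real"
  obtain t where t: "t \<in> X" "transvection p n t" using ex by blast
  have p2: "2 \<le> p" using prime prime_ge_2_nat by blast
  have ln: "1 / 2 \<le> ln (real p)"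
  proof -
    have "ln 2 \<le> ln (real p)" using p2 by (subst ln_le_cancel_iff) auto
    then show ?thesis using half_le_ln_two by linarith
  qed
  then have powr: "ln (real p) powr 22 = ln (real p) ^ 22" using powr_realpow[of "ln (real p)" 22] by simp
  have n2: "9 \<le> (real n)\<^sup>2"
  proof -
    have "3\<^sup>2 \<le> (real n)\<^sup>2" using n by (intro power_mono) auto
    then show ?thesis by simp
  qed
  show "\<exists>l. real l \<le> 9 * ?C * ln (real p) powr 22 * (real n)\<^sup>2 \<and>
          (\<exists>s. transvection p n s \<and> transvection_group p n s \<subseteq> Xpow p n X l)"
  proof (cases "p = 2")
    case True
    \<comment> \<open>As ln 2 < 1, its power shrinks the bound, and the large constant has to keep
      it above 1.\<close>
    have "(1 / 2) ^ 22 \<le> ln (real p) ^ 22" using ln by (intro power_mono) auto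
    then have "9 * ?C * (1 / 2) ^ 22 * 9 \<le> 9 * ?C * ln (real p) ^ 22 * (real n)\<^sup>2"
      using n2 by (intro mult_mono mult_nonneg_nonneg) auto
    moreover have "1 \<le> 9 * ?C * (1 / 2) ^ 22 * 9" by (simp add: power_divide)
    ultimately have "real 1 \<le> 9 * ?C * ln (real p) powr 22 * (real n)\<^sup>2" unfolding powr by linarith
    moreover have "transvection_group p n t \<subseteq> Xpow p n X 1"
      using transvection_group_two X t True by blast
    ultimately show ?thesis using t(2) by blast
  next
    case False
    interpret sl_generators p n X using prime X by unfold_locales
    obtain k where k: "p < 2 ^ k" "real k \<le> 4 * ln (real p)" using exists_power_of_two[OF p2] .
    let ?K = "k * (n * n)"
    have "p ^ (n * n) < (2 ^ k) ^ (n * n)" using k(1) n by (intro power_strict_mono) auto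
    then have K: "p ^ (n * n) < 2 ^ ?K" by (simp add: power_mult)
    obtain l where l: "real l \<le> ?C * ln (real p) ^ 21"
      and sub: "transvection_group p n t \<subseteq> Xpow p n X (l * (2 * ?K + 1))"
      using transvection_group_in_power[OF False K t] by blast
    have "real (2 * ?K + 1) \<le> 9 * ln (real p) * (real n)\<^sup>2"
    proof -
      have "real k * (real n)\<^sup>2 \<le> 4 * ln (real p) * (real n)\<^sup>2" using k(2) by (intro mult_right_mono) auto
      moreover have "1 / 2 * 9 \<le> ln (real p) * (real n)\<^sup>2" using ln n2 by (intro mult_mono) auto
      ultimately show ?thesis by (simp add: power2_eq_square)
    qed
    then have "real (l * (2 * ?K + 1)) \<le> (?C * ln (real p) ^ 21) * (9 * ln (real p) * (real n)\<^sup>2)"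
      unfolding of_nat_mult[of l] using l ln by (intro mult_mono) auto
    also have "\<dots> = 9 * ?C * ln (real p) powr 22 * (real n)\<^sup>2"
      unfolding powr by (simp add: power_Suc[of "ln (real p)" 21, simplified] mult_ac)
    finally show ?thesis using sub t(2) by blast
  qed
qed simp_all

end
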